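(* Let $\Sigma\subset\mathbb{N}$ be a finite alphabet, let $\varphi:\Sigma^*\to\Sigma^*$ be a Parikh-collinear morphism prolongable on a letter $a$, and let $\mathbf{x}=\varphi^\omega(a)$. Then the additive complexity function $\rho^{\mathrm{add}}_{\mathbf{x}}$ is $k$-automatic for $k=\sum_{b\in\Sigma}|\varphi(b)|_b$. Moreover, a DFAO generating $\rho^{\mathrm{add}}_{\mathbf{x}}$ can be effectively computed from $\varphi$ and $a$.
   Context: A morphism $\varphi:\Sigma^*\to\Sigma^*$ is Parikh-collinear if the Parikh vectors $(|\varphi(b)|_c)_{c\in\Sigma}$, $b\in\Sigma$, are pairwise collinear (rank at most 1). It is prolongable on $a$ if $\varphi(a)$ begins with $a$ and $|\varphi^n(a)|\to\infty$; $\varphi^\omega(a)$ is the resulting infinite fixed point. A sequence is $k$-automatic if some deterministic finite automaton with output, reading the base-$k$ representation of $n$, outputs its $n$th term. Words $u,v$ are additively equivalent if $|u|=|v|$ and $\sum_c c|u|_c=\sum_c c|v|_c$; $\rho^{\mathrm{add}}_{\mathbf{x}}(n)$ is the number of additive equivalence classes of length-$n$ factors of $\mathbf{x}$. *)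

theory Defs
  imports Complex_Main "HOL-Library.Nat_Bijection" "HOL-Library.Sublist"
begin

section \<open>Morphisms and their fixed points\<close>

definition is_morphism :: "nat set \<Rightarrow> (nat list \<Rightarrow> nat list) \<Rightarrow> bool" where
  "is_morphism \<Sigma> \<phi> \<longleftrightarrow>
     (\<forall>u\<in>lists \<Sigma>. \<phi> u \<in> lists \<Sigma>) \<and>
     (\<forall>u\<in>lists \<Sigma>. \<forall>v\<in>lists \<Sigma>. \<phi> (u @ v) = \<phi> u @ \<phi> v)"

definition parikh :: "nat list \<Rightarrow> nat \<Rightarrow> nat" where
  "parikh w c = count_list w c"

definition collinear_on :: "nat set \<Rightarrow> (nat \<Rightarrow> nat) \<Rightarrow> (nat \<Rightarrow> nat) \<Rightarrow> bool" where
  "collinear_on \<Sigma> u v \<longleftrightarrow>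
     (\<exists>r s :: rat. (r \<noteq> 0 \<or> s \<noteq> 0) \<and> (\<forall>c\<in>\<Sigma>. r * of_nat (u c) = s * of_nat (v c)))"

text \<open>Erasing morphisms are allowed: the zero vector is collinear with every vector.\<close>

definition parikh_collinear :: "nat set \<Rightarrow> (nat list \<Rightarrow> nat list) \<Rightarrow> bool" where
  "parikh_collinear \<Sigma> \<phi> \<longleftrightarrow>
     (\<forall>b\<in>\<Sigma>. \<forall>b'\<in>\<Sigma>. collinear_on \<Sigma> (parikh (\<phi> [b])) (parikh (\<phi> [b'])))"

definition prolongable :: "(nat list \<Rightarrow> nat list) \<Rightarrow> nat \<Rightarrow> bool" where
  "prolongable \<phi> a \<longleftrightarrow>
     prefix [a] (\<phi> [a]) \<and>
     filterlim (\<lambda>n. length ((\<phi> ^^ n) [a])) at_top sequentially"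

text \<open>
  For a morphism prolongable on \<open>a\<close>, every iterate is a prefix of the next, so any iterate
  of length greater than \<open>i\<close> has the same \<open>i\<close>-th letter (lemma \<open>fixed_point_nth\<close> below).
\<close>

definition fixed_point :: "(nat list \<Rightarrow> nat list) \<Rightarrow> nat \<Rightarrow> nat \<Rightarrow> nat" where
  "fixed_point \<phi> a i = (\<phi> ^^ (LEAST m. i < length ((\<phi> ^^ m) [a]))) [a] ! i"

lemma prefix_iterates:
  assumes "is_morphism \<Sigma> \<phi>" "a \<in> \<Sigma>" "prolongable \<phi> a" "m \<le> n"
  shows "prefix ((\<phi> ^^ m) [a]) ((\<phi> ^^ n) [a])"
proof -
  have in_lists: "(\<phi> ^^ i) u \<in> lists \<Sigma>" if "u \<in> lists \<Sigma>" for i u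
    using that assms(1) by (induction i) (auto simp: is_morphism_def simp del: in_lists_conv_set)
  have app: "(\<phi> ^^ i) (u @ v) = (\<phi> ^^ i) u @ (\<phi> ^^ i) v"
    if "u \<in> lists \<Sigma>" "v \<in> lists \<Sigma>" for i u v
    using that assms(1) in_lists
    by (induction i) (auto simp: is_morphism_def simp del: in_lists_conv_set)
  obtain w where w: "\<phi> [a] = [a] @ w"
    using assms(3) by (auto simp: prolongable_def prefix_def)
  have a: "[a] \<in> lists \<Sigma>" using assms(2) by simp
  have "\<phi> [a] \<in> lists \<Sigma>" using a assms(1) unfolding is_morphism_def by blast
  then have "w \<in> lists \<Sigma>" using w by simp
  then have "prefix ((\<phi> ^^ i) [a]) ((\<phi> ^^ Suc i) [a])" for i
    using app[OF a, of w i] w by (simp add: funpow_Suc_right del: funpow.simps)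
  then show ?thesis
    using assms(4) by (rule prefix_order.lift_Suc_mono_le)
qed

lemma fixed_point_nth:
  assumes "is_morphism \<Sigma> \<phi>" "a \<in> \<Sigma>" "prolongable \<phi> a" "i < length ((\<phi> ^^ n) [a])"
  shows "fixed_point \<phi> a i = (\<phi> ^^ n) [a] ! i"
proof -
  define m where "m = (LEAST m. i < length ((\<phi> ^^ m) [a]))"
  have "m \<le> n" "i < length ((\<phi> ^^ m) [a])"
    unfolding m_def using assms(4) by (auto intro: Least_le LeastI)
  with prefix_iterates[OF assms(1-3)] have "prefix ((\<phi> ^^ m) [a]) ((\<phi> ^^ n) [a])" by blast
  with \<open>i < length ((\<phi> ^^ m) [a])\<close> show ?thesis
    unfolding fixed_point_def m_def[symmetric] by (auto simp: prefix_def nth_append)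
qed

section \<open>Additive complexity\<close>

definition factors :: "(nat \<Rightarrow> nat) \<Rightarrow> nat \<Rightarrow> nat list set" where
  "factors x n = {map x [i..<i + n] | i. True}"

definition additive_equiv :: "nat set \<Rightarrow> (nat list \<times> nat list) set" where
  "additive_equiv \<Sigma> =
     {(u, v). u \<in> lists \<Sigma> \<and> v \<in> lists \<Sigma> \<and> length u = length v \<and>
        (\<Sum>c\<in>\<Sigma>. c * count_list u c) = (\<Sum>c\<in>\<Sigma>. c * count_list v c)}"

definition additive_complexity :: "nat set \<Rightarrow> (nat \<Rightarrow> nat) \<Rightarrow> nat \<Rightarrow> nat" where
  "additive_complexity \<Sigma> x n = card (factors x n // additive_equiv \<Sigma>)"

section \<open>Automatic sequences\<close>

text \<open>
  The base-\<open>k\<close> representation without leading zeros, most significant digit first;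
  zero is represented by the empty word.  Only \<open>k \<ge> 2\<close> is meaningful.
\<close>

function base_rep :: "nat \<Rightarrow> nat \<Rightarrow> nat list" where
  "base_rep k n = (if k < 2 \<or> n = 0 then [] else base_rep k (n div k) @ [n mod k])"
  by auto
termination
  by (relation "measure snd") auto

declare base_rep.simps [simp del]

text \<open>
  A DFAO over the input alphabet \<open>{0..<k}\<close>, given by its tables: the states are
  \<open>0, \<dots>, length (out M) - 1\<close>, the entry \<open>trans M ! q ! d\<close> is the successor of the
  state \<open>q\<close> under the digit \<open>d\<close>, and \<open>out M ! q\<close> is the output of \<open>q\<close>.
\<close>

datatype dfao = DFAO (init: nat) (trans: "nat list list") (out: "nat list")

definition wf_dfao :: "nat \<Rightarrow> dfao \<Rightarrow> bool" where
  "wf_dfao k M \<longleftrightarrow>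
     init M < length (out M) \<and> length (trans M) = length (out M) \<and>
     (\<forall>row\<in>set (trans M). length row = k \<and> (\<forall>q\<in>set row. q < length (out M)))"

definition dfao_output :: "dfao \<Rightarrow> nat list \<Rightarrow> nat" where
  "dfao_output M w = out M ! foldl (\<lambda>q d. trans M ! q ! d) (init M) w"

definition generates :: "nat \<Rightarrow> dfao \<Rightarrow> (nat \<Rightarrow> nat) \<Rightarrow> bool" where
  "generates k M f \<longleftrightarrow>
     k \<ge> 2 \<and> wf_dfao k M \<and> (\<forall>n. dfao_output M (base_rep k n) = f n)"

definition automatic :: "nat \<Rightarrow> (nat \<Rightarrow> nat) \<Rightarrow> bool" where
  "automatic k f \<longleftrightarrow> (\<exists>M. generates k M f)"

section \<open>Effective computability\<close>

text \<open>
  \<open>partial_recursive n f\<close> states that \<open>f\<close>, on argument lists of length \<open>n\<close>, is a partial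
  recursive function; \<open>None\<close> means undefined.  The values of \<open>f\<close> on lists of another length
  are irrelevant and never used by the closure rules.  In \<open>prec\<close> the recursion argument is the
  head of the list, and in \<open>mu\<close> all values below the least zero have to be defined.
\<close>

inductive partial_recursive :: "nat \<Rightarrow> (nat list \<Rightarrow> nat option) \<Rightarrow> bool" where
  zero: "partial_recursive n (\<lambda>xs. Some 0)"
| suc: "partial_recursive 1 (\<lambda>xs. Some (Suc (xs ! 0)))"
| proj: "i < n \<Longrightarrow> partial_recursive n (\<lambda>xs. Some (xs ! i))"
| comp: "partial_recursive (length hs) g \<Longrightarrow> \<forall>h\<in>set hs. partial_recursive n h \<Longrightarrow>
    partial_recursive n
      (\<lambda>xs. if \<exists>h\<in>set hs. h xs = None then None else g (map (\<lambda>h. the (h xs)) hs))"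
| prec: "partial_recursive n f \<Longrightarrow> partial_recursive (n + 2) g \<Longrightarrow>
    partial_recursive (n + 1)
      (\<lambda>xs. rec_nat (f (tl xs)) (\<lambda>y r. Option.bind r (\<lambda>z. g (y # z # tl xs))) (hd xs))"
| mu: "partial_recursive (n + 1) f \<Longrightarrow>
    partial_recursive n
      (\<lambda>xs. if \<exists>y. f (y # xs) = Some 0 \<and> (\<forall>z<y. f (z # xs) \<noteq> None)
            then Some (LEAST y. f (y # xs) = Some 0) else None)"

definition computable :: "(nat \<Rightarrow> nat option) \<Rightarrow> bool" where
  "computable F \<longleftrightarrow> (\<exists>f. partial_recursive 1 f \<and> (\<forall>x. F x = f [x]))"

text \<open>
  Numerical codes of the input, i.e. the letter \<open>a\<close> and the finite table of the words
  \<open>\<phi>(b)\<close> for the letters \<open>b\<close> in increasing order, and of the tables of a DFAO.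
\<close>

definition encode_morphism :: "nat set \<Rightarrow> (nat list \<Rightarrow> nat list) \<Rightarrow> nat \<Rightarrow> nat" where
  "encode_morphism \<Sigma> \<phi> a =
     prod_encode
       (list_encode (map (\<lambda>b. prod_encode (b, list_encode (\<phi> [b]))) (sorted_list_of_set \<Sigma>)), a)"

definition encode_dfao :: "dfao \<Rightarrow> nat" where
  "encode_dfao M =
     prod_encode (init M,
       prod_encode (list_encode (map list_encode (trans M)), list_encode (out M)))"

lemma inj_encode_dfao: "inj encode_dfao"
proof (rule injI)
  fix M N assume "encode_dfao M = encode_dfao N"
  then show "M = N"
    by (auto simp: encode_dfao_def list_encode_eq inj_map_eq_map[OF inj_list_encode]
             intro: dfao.expand)
qed

section \<open>Instances\<close>

definition admissible :: "nat set \<Rightarrow> (nat list \<Rightarrow> nat list) \<Rightarrow> nat \<Rightarrow> bool" where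
  "admissible \<Sigma> \<phi> a \<longleftrightarrow>
     finite \<Sigma> \<and> is_morphism \<Sigma> \<phi> \<and> parikh_collinear \<Sigma> \<phi> \<and> a \<in> \<Sigma> \<and> prolongable \<phi> a"

definition trace_morphism :: "nat set \<Rightarrow> (nat list \<Rightarrow> nat list) \<Rightarrow> nat" where
  "trace_morphism \<Sigma> \<phi> = (\<Sum>b\<in>\<Sigma>. count_list (\<phi> [b]) b)"

end

theory Submission
  imports Defs
begin

text \<open>
  Let \<open>\<phi>\<close> be Parikh-collinear with trace \<open>k\<close>. The vanishing \<open>2 \<times> 2\<close> minors of its matrix give
  \<open>|\<phi>(\<phi>(w))| = k |\<phi>(w)|\<close> and show that all blocks \<open>\<phi>(b)\<close> have the same mean letter. Label the
  position \<open>i = |\<phi>(x\<^sub>0 \<dots> x\<^sub>j\<^sub>-\<^sub>1)| + p\<close>, \<open>p < |\<phi>(x\<^sub>j)|\<close>, of \<open>\<bold>x = \<phi>(\<bold>x)\<close> by the node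
  \<open>u\<^sub>i = (x\<^sub>j, p)\<close>. By the first fact \<open>u\<close> is a fixed point of a \<open>k\<close>-uniform morphism; by the second one the
  letter sum of \<open>x\<^sub>i \<dots> x\<^bsub>i+n-1\<^esub>\<close> is determined by \<open>n\<close>, \<open>u\<^sub>i\<close> and \<open>u\<^bsub>i+n\<^esub>\<close>. So the complexity at \<open>n\<close>
  can be read off the finite set \<open>V\<^sub>n = {(u\<^sub>i, u\<^bsub>i+n\<^esub>, u\<^bsub>i+n+1\<^esub>) | i}\<close>, and \<open>V\<^bsub>kn+d\<^esub>\<close> is a function of
  \<open>V\<^sub>n\<close> and the digit \<open>d\<close>: the states of the automaton are the sets of triples of nodes. Its initial
  state \<open>V\<^sub>0\<close> is the least set that contains \<open>(u\<^sub>0, u\<^sub>0, u\<^sub>1)\<close> and is closed under the transition for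
  the digit \<open>0\<close>, hence an intersection over the finitely many sets of triples, so that the whole
  automaton is computed by a primitive recursive list program.
\<close>

section \<open>Total recursive functions on numbers\<close>

text \<open>Agreement is asked for only on lists of length \<open>n\<close>, since the values of a
  partial recursive function on other lists carry no information.\<close>

definition total_recursive :: "nat \<Rightarrow> (nat list \<Rightarrow> nat) \<Rightarrow> bool" where
  "total_recursive n f \<longleftrightarrow>
     (\<exists>g. partial_recursive n g \<and> (\<forall>xs. length xs = n \<longrightarrow> g xs = Some (f xs)))"

lemma total_recursive_cong:
  assumes "total_recursive n f" "\<And>xs. length xs = n \<Longrightarrow> f xs = g xs"
  shows "total_recursive n g"
  using assms unfolding total_recursive_def by fastforce

lemma total_recursive_proj: "i < n \<Longrightarrow> total_recursive n (\<lambda>xs. xs ! i)"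
  unfolding total_recursive_def using partial_recursive.proj by blast

lemma total_recursive_comp:
  assumes g: "total_recursive (length hs) g" and hs: "\<forall>h\<in>set hs. total_recursive n h"
  shows "total_recursive n (\<lambda>xs. g (map (\<lambda>h. h xs) hs))"
proof -
  obtain g' where g': "partial_recursive (length hs) g'"
    "\<And>xs. length xs = length hs \<Longrightarrow> g' xs = Some (g xs)"
    using g unfolding total_recursive_def by blast
  have "\<forall>h\<in>set hs. \<exists>h'. partial_recursive n h' \<and> (\<forall>xs. length xs = n \<longrightarrow> h' xs = Some (h xs))"
    using hs unfolding total_recursive_def by blast
  from bchoice[OF this] obtain H where H: "\<forall>h\<in>set hs. partial_recursive n (H h) \<and>
    (\<forall>xs. length xs = n \<longrightarrow> H h xs = Some (h xs))" ..
  have "partial_recursive n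
      (\<lambda>xs. if \<exists>h\<in>set (map H hs). h xs = None then None
         else g' (map (\<lambda>h. the (h xs)) (map H hs)))"
    by (rule partial_recursive.comp) (use g' H in auto)
  moreover have "(if \<exists>h\<in>set (map H hs). h xs = None then None
         else g' (map (\<lambda>h. the (h xs)) (map H hs))) = Some (g (map (\<lambda>h. h xs) hs))"
    if "length xs = n" for xs
  proof -
    have "map (\<lambda>h. the (h xs)) (map H hs) = map (\<lambda>h. h xs) hs"
      using H that by simp
    then show ?thesis
      using H that g'(2)[of "map (\<lambda>h. h xs) hs"] by (simp del: map_map)
  qed
  ultimately show ?thesis
    unfolding total_recursive_def by blast
qed

lemma total_recursive_prec:
  assumes f: "total_recursive n f" and g: "total_recursive (n + 2) g"
  shows "total_recursive (n + 1) (\<lambda>xs. rec_nat (f (tl xs)) (\<lambda>y r. g (y # r # tl xs)) (hd xs))"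
proof -
  obtain f' where f': "partial_recursive n f'" "\<And>xs. length xs = n \<Longrightarrow> f' xs = Some (f xs)"
    using f unfolding total_recursive_def by blast
  obtain g' where g': "partial_recursive (n + 2) g'"
    "\<And>xs. length xs = n + 2 \<Longrightarrow> g' xs = Some (g xs)"
    using g unfolding total_recursive_def by blast
  have "rec_nat (f' zs) (\<lambda>y r. Option.bind r (\<lambda>z. g' (y # z # zs))) m =
      Some (rec_nat (f zs) (\<lambda>y r. g (y # r # zs)) m)" if "length zs = n" for m zs
    using that f'(2) g'(2) by (induction m) auto
  then have "\<forall>xs. length xs = n + 1 \<longrightarrow>
      rec_nat (f' (tl xs)) (\<lambda>y r. Option.bind r (\<lambda>z. g' (y # z # tl xs))) (hd xs) =
      Some (rec_nat (f (tl xs)) (\<lambda>y r. g (y # r # tl xs)) (hd xs))"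
    by simp
  with partial_recursive.prec[OF f'(1) g'(1)] show ?thesis
    unfolding total_recursive_def by blast
qed

abbreviation total_recursive1 :: "(nat \<Rightarrow> nat) \<Rightarrow> bool" where
  "total_recursive1 f \<equiv> total_recursive 1 (\<lambda>xs. f (xs ! 0))"

abbreviation total_recursive2 :: "(nat \<Rightarrow> nat \<Rightarrow> nat) \<Rightarrow> bool" where
  "total_recursive2 f \<equiv> total_recursive 2 (\<lambda>xs. f (xs ! 0) (xs ! 1))"

lemma total_recursive_app1:
  assumes "total_recursive1 g" "total_recursive n f"
  shows "total_recursive n (\<lambda>xs. g (f xs))"
  using total_recursive_comp[of "[f]" "\<lambda>xs. g (xs ! 0)" n] assms by simp

lemma total_recursive_app2:
  assumes "total_recursive2 g" "total_recursive n f" "total_recursive n h"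
  shows "total_recursive n (\<lambda>xs. g (f xs) (h xs))"
  using total_recursive_comp[of "[f, h]" "\<lambda>xs. g (xs ! 0) (xs ! 1)" n] assms
  by (simp add: numeral_2_eq_2)

lemma total_recursive_Suc: "total_recursive n f \<Longrightarrow> total_recursive n (\<lambda>xs. Suc (f xs))"
  by (rule total_recursive_app1) (use partial_recursive.suc in \<open>auto simp: total_recursive_def\<close>)

lemma total_recursive_const: "total_recursive n (\<lambda>xs. c)"
proof (induction c)
  case 0
  show ?case using partial_recursive.zero unfolding total_recursive_def by blast
qed (rule total_recursive_Suc)

text \<open>\<open>partial_recursive.prec\<close> recurses on the head of its argument list;
  composing it with \<open>c\<close> followed by all \<open>n\<close> projections makes the whole
  list \<open>xs\<close> the parameter of the recursion.\<close>

lemma total_recursive_rec_nat: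
  assumes b: "total_recursive n b"
    and s: "total_recursive (n + 2) (\<lambda>xs. s (xs ! 0) (xs ! 1) (drop 2 xs))"
    and c: "total_recursive n c"
  shows "total_recursive n (\<lambda>xs. rec_nat (b xs) (\<lambda>y r. s y r xs) (c xs))"
proof -
  let ?g = "\<lambda>zs. rec_nat (b (tl zs)) (\<lambda>y r. s y r (tl zs)) (hd zs)"
  let ?hs = "c # map (\<lambda>i xs. xs ! i) [0..<n]"
  have "total_recursive (length ?hs) ?g"
    using total_recursive_prec[OF b s] by simp
  moreover have "\<forall>h\<in>set ?hs. total_recursive n h"
    using c by (auto intro: total_recursive_proj)
  ultimately have "total_recursive n (\<lambda>xs. ?g (map (\<lambda>h. h xs) ?hs))"
    by (rule total_recursive_comp)
  then show ?thesis
  proof (rule total_recursive_cong)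
    fix xs :: "nat list"
    assume "length xs = n"
    then have "map (\<lambda>i. xs ! i) [0..<n] = xs" by (auto intro: nth_equalityI)
    then show "?g (map (\<lambda>h. h xs) ?hs) = rec_nat (b xs) (\<lambda>y r. s y r xs) (c xs)"
      by (simp add: comp_def)
  qed
qed

text \<open>Inside a recursion step the counter and the accumulator precede the parameters; this
  rule reaches behind them.\<close>

lemma total_recursive_drop:
  assumes "total_recursive n f"
  shows "total_recursive (n + m) (\<lambda>xs. f (drop m xs))"
proof -
  let ?hs = "map (\<lambda>i xs. xs ! (m + i)) [0..<n]"
  have "total_recursive (n + m) (\<lambda>xs. f (map (\<lambda>h. h xs) ?hs))"
    by (rule total_recursive_comp) (use assms in \<open>auto intro: total_recursive_proj\<close>)
  then show ?thesis
  proof (rule total_recursive_cong)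
    fix xs :: "nat list"
    assume "length xs = n + m"
    then show "f (map (\<lambda>h. h xs) ?hs) = f (drop m xs)"
      by (intro arg_cong[of _ _ f] nth_equalityI) auto
  qed
qed

section \<open>Arithmetic by primitive recursion\<close>

lemma total_recursive_plus:
  assumes "total_recursive n f" "total_recursive n g"
  shows "total_recursive n (\<lambda>xs. f xs + g xs)"
proof -
  have "rec_nat x (\<lambda>y. Suc) m = x + m" for x m :: nat
    by (induction m) auto
  then show ?thesis
    using total_recursive_rec_nat[of n f "\<lambda>y r _. Suc r" g] assms
    by (simp add: total_recursive_Suc total_recursive_proj)
qed

lemma total_recursive_times:
  assumes "total_recursive n f" "total_recursive n g"
  shows "total_recursive n (\<lambda>xs. f xs * g xs)"
proof -
  have eq: "rec_nat 0 (\<lambda>y r. r + x) m = x * m" for x m :: nat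
    by (induction m) auto
  have "total_recursive n (\<lambda>xs. rec_nat 0 (\<lambda>y r. r + f xs) (g xs))"
    by (intro total_recursive_rec_nat assms total_recursive_plus total_recursive_const
        total_recursive_proj total_recursive_drop) auto
  then show ?thesis by (simp add: eq)
qed

lemma total_recursive_minus:
  assumes "total_recursive n f" "total_recursive n g"
  shows "total_recursive n (\<lambda>xs. f xs - g xs)"
proof -
  have pred: "total_recursive m (\<lambda>xs. h xs - 1)" if "total_recursive m h" for m h
  proof -
    have eq: "rec_nat 0 (\<lambda>y r. y) m = m - 1" for m :: nat
      by (cases m) auto
    have "total_recursive m (\<lambda>xs. rec_nat 0 (\<lambda>y r. y) (h xs))"
      by (intro total_recursive_rec_nat that total_recursive_const total_recursive_proj) auto
    then show ?thesis by (simp add: eq)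
  qed
  have eq: "rec_nat x (\<lambda>y r. r - 1) m = x - m" for x m :: nat
    by (induction m) auto
  have "total_recursive n (\<lambda>xs. rec_nat (f xs) (\<lambda>y r. r - 1) (g xs))"
    by (intro total_recursive_rec_nat assms pred total_recursive_proj) auto
  then show ?thesis by (simp only: eq)
qed

lemma total_recursive_If_zero:
  assumes "total_recursive n c" "total_recursive n f" "total_recursive n g"
  shows "total_recursive n (\<lambda>xs. if c xs = 0 then f xs else g xs)"
proof -
  \<comment> \<open>\<open>1 - c xs\<close> is the indicator of \<open>c xs = 0\<close>, and
    \<open>1 - (1 - c xs)\<close> is its complement.\<close>
  have "total_recursive n (\<lambda>xs. f xs * (1 - c xs) + g xs * (1 - (1 - c xs)))"
    by (intro assms total_recursive_plus total_recursive_times total_recursive_minus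
        total_recursive_const)
  then show ?thesis by (rule total_recursive_cong) auto
qed

section \<open>The Cantor pairing and its inverse\<close>

lemma total_recursive_triangle:
  assumes "total_recursive n f"
  shows "total_recursive n (\<lambda>xs. triangle (f xs))"
proof -
  have eq: "rec_nat 0 (\<lambda>y r. r + Suc y) m = triangle m" for m
    by (induction m) auto
  have "total_recursive n (\<lambda>xs. rec_nat 0 (\<lambda>y r. r + Suc y) (f xs))"
    by (intro total_recursive_rec_nat assms total_recursive_plus total_recursive_Suc
        total_recursive_const total_recursive_proj) auto
  then show ?thesis by (simp only: eq)
qed

lemma total_recursive_prod_encode:
  assumes "total_recursive n f" "total_recursive n g"
  shows "total_recursive n (\<lambda>xs. prod_encode (f xs, g xs))"
  unfolding prod_encode_def
  using assms by (auto intro!: total_recursive_plus total_recursive_triangle)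

text \<open>The antidiagonal of the Cantor pairing that contains \<open>z\<close>, i.e. the largest
  \<open>w\<close> with \<open>triangle w \<le> z\<close>. From \<open>z\<close> to
  \<open>Suc z\<close> it grows by one exactly when the next triangular number is reached; the
  truncated difference tests this.\<close>

definition diagonal :: "nat \<Rightarrow> nat" where
  "diagonal = rec_nat 0 (\<lambda>z w. if triangle (Suc w) - Suc z = 0 then Suc w else w)"

lemma triangle_mono: "m \<le> n \<Longrightarrow> triangle m \<le> triangle n"
  unfolding triangle_def by (intro div_le_mono mult_le_mono) auto

lemma triangle_diagonal: "triangle (diagonal z) \<le> z \<and> z < triangle (Suc (diagonal z))"
  by (induction z) (auto simp: diagonal_def)

text \<open>Both sides enclose the code between consecutive triangular numbers, so they coincide
  because \<open>triangle\<close> is monotone.\<close>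

lemma diagonal_prod_encode: "diagonal (prod_encode (m, n)) = m + n"
proof -
  let ?z = "prod_encode (m, n)"
  have "triangle (m + n) \<le> ?z" "?z < triangle (Suc (m + n))"
    by (auto simp: prod_encode_def)
  then show ?thesis
    using triangle_diagonal[of ?z] triangle_mono[of "Suc (diagonal ?z)" "m + n"]
      triangle_mono[of "Suc (m + n)" "diagonal ?z"]
    by linarith
qed

text \<open>Since \<open>prod_encode (m, n) = triangle (m + n) + m\<close>, removing the triangular
  number leaves \<open>m\<close>, and removing \<open>m\<close> from the antidiagonal
  \<open>m + n\<close> leaves \<open>n\<close>.\<close>

lemma fst_prod_decode: "fst (prod_decode z) = z - triangle (diagonal z)"
  and snd_prod_decode: "snd (prod_decode z) = diagonal z - (z - triangle (diagonal z))"
proof -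
  obtain m n where z: "z = prod_encode (m, n)"
    by (metis prod_decode_inverse surj_pair)
  show "fst (prod_decode z) = z - triangle (diagonal z)"
    "snd (prod_decode z) = diagonal z - (z - triangle (diagonal z))"
    by (simp_all add: z diagonal_prod_encode) (simp_all add: prod_encode_def)
qed

lemma total_recursive_diagonal:
  assumes "total_recursive n f"
  shows "total_recursive n (\<lambda>xs. diagonal (f xs))"
  unfolding diagonal_def
  by (intro total_recursive_rec_nat assms total_recursive_If_zero total_recursive_triangle
      total_recursive_minus total_recursive_Suc total_recursive_const total_recursive_proj) auto

lemma total_recursive_prod_decode:
  assumes "total_recursive n f"
  shows "total_recursive n (\<lambda>xs. fst (prod_decode (f xs)))"
    and "total_recursive n (\<lambda>xs. snd (prod_decode (f xs)))"
  unfolding fst_prod_decode snd_prod_decode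
  using assms by (auto intro!: total_recursive_minus total_recursive_triangle total_recursive_diagonal)

section \<open>Recursive functions on encodable types\<close>

text \<open>Numerical codes for types allow the automaton to be programmed with pairs and lists
  instead of bare numbers; injectivity lets equality of values be tested on codes.\<close>

class encodable =
  fixes encode :: "'a \<Rightarrow> nat"
  assumes inj_encode: "inj encode"
begin

lemma encode_eq_iff: "encode x = encode y \<longleftrightarrow> x = y"
  using inj_encode by (auto dest: injD)

end

instantiation nat :: encodable
begin
definition "encode_nat (n :: nat) = n"
instance by standard (auto simp: encode_nat_def inj_def)
end

instantiation bool :: encodable
begin
definition "encode_bool b = (if b then 1 else 0 :: nat)"
instance by standard (auto simp: encode_bool_def inj_def split: if_splits)
end

instantiation prod :: (encodable, encodable) encodable
begin
definition "encode_prod p = prod_encode (encode (fst p), encode (snd p))"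
instance by standard (auto simp: encode_prod_def inj_def encode_eq_iff)
end

instantiation list :: (encodable) encodable
begin
definition "encode_list xs = list_encode (map encode xs)"
instance
proof
  show "inj (encode :: 'a list \<Rightarrow> nat)"
    using inj_list_encode by (auto simp: encode_list_def inj_def list_encode_eq
        inj_map_eq_map[OF inj_encode])
qed
end

lemma encode_Nil: "encode [] = 0"
  and encode_Cons: "encode (x # xs) = Suc (prod_encode (encode x, encode xs))"
  by (simp_all add: encode_list_def)

text \<open>The values of \<open>g\<close> at numbers that are not codes are free, so the range of
  \<open>encode\<close> never has to be decided.\<close>

definition tracks :: "(nat \<Rightarrow> nat) \<Rightarrow> ('a::encodable \<Rightarrow> 'b::encodable) \<Rightarrow> bool" where
  "tracks g f \<longleftrightarrow> total_recursive1 g \<and> (\<forall>x. g (encode x) = encode (f x))"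

definition recursive :: "('a::encodable \<Rightarrow> 'b::encodable) \<Rightarrow> bool" where
  "recursive f \<longleftrightarrow> (\<exists>g. tracks g f)"

lemma recursiveI:
  assumes "total_recursive 1 (\<lambda>xs. g (xs ! 0))" "\<And>x. g (encode x) = encode (f x)"
  shows "recursive f"
  using assms unfolding recursive_def tracks_def by blast

lemma total_recursive_tracks:
  "tracks g f \<Longrightarrow> total_recursive n h \<Longrightarrow> total_recursive n (\<lambda>xs. g (h xs))"
  unfolding tracks_def by (blast intro: total_recursive_app1)

lemma tracks_encode: "tracks g f \<Longrightarrow> g (encode x) = encode (f x)"
  unfolding tracks_def by blast

section \<open>Closure rules for functions on encodable types\<close>

named_theorems recursive_intros

lemma recursive_id [recursive_intros]: "recursive (\<lambda>x. x)"
  by (rule recursiveI[of "\<lambda>x. x"]) (simp_all add: total_recursive_proj)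

lemma recursive_const [recursive_intros]: "recursive (\<lambda>x. c)"
  by (rule recursiveI[of "\<lambda>x. encode c"]) (simp_all add: total_recursive_const)

lemma recursive_encode [recursive_intros]:
  assumes "recursive f"
  shows "recursive (\<lambda>x. encode (f x))"
  using assms unfolding recursive_def tracks_def by (simp add: encode_nat_def)

lemma recursive_fst [recursive_intros]:
  assumes "recursive f"
  shows "recursive (\<lambda>x. fst (f x))"
proof -
  obtain g where g: "tracks g f"
    using assms unfolding recursive_def by blast
  show ?thesis
    by (rule recursiveI[of "\<lambda>x. fst (prod_decode (g x))"])
      (auto simp: tracks_encode[OF g] encode_prod_def
        intro!: total_recursive_tracks[OF g] total_recursive_prod_decode
        total_recursive_proj)
qed

lemma recursive_snd [recursive_intros]:
  assumes "recursive f"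
  shows "recursive (\<lambda>x. snd (f x))"
proof -
  obtain g where g: "tracks g f"
    using assms unfolding recursive_def by blast
  show ?thesis
    by (rule recursiveI[of "\<lambda>x. snd (prod_decode (g x))"])
      (auto simp: tracks_encode[OF g] encode_prod_def
        intro!: total_recursive_tracks[OF g] total_recursive_prod_decode
        total_recursive_proj)
qed

lemma recursive_Pair [recursive_intros]:
  assumes "recursive f" "recursive f'"
  shows "recursive (\<lambda>x. (f x, f' x))"
proof -
  obtain g where g: "tracks g f"
    using assms(1) unfolding recursive_def by blast
  obtain g' where g': "tracks g' f'"
    using assms(2) unfolding recursive_def by blast
  show ?thesis
    by (rule recursiveI[of "\<lambda>x. prod_encode (g x, g' x)"])
      (auto simp: tracks_encode[OF g] tracks_encode[OF g'] encode_prod_def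
        intro!: total_recursive_tracks[OF g] total_recursive_tracks[OF g'] total_recursive_prod_encode
        total_recursive_proj)
qed

lemma recursive_comp:
  assumes "recursive f" "recursive h"
  shows "recursive (\<lambda>x. f (h x))"
proof -
  obtain g where g: "tracks g f"
    using assms(1) unfolding recursive_def by blast
  obtain g' where g': "tracks g' h"
    using assms(2) unfolding recursive_def by blast
  show ?thesis
    by (rule recursiveI[of "\<lambda>x. g (g' x)"])
      (auto simp: tracks_encode[OF g] tracks_encode[OF g']
        intro!: total_recursive_tracks[OF g] total_recursive_tracks[OF g'] total_recursive_proj)
qed

text \<open>
  In the rules for constants that bind variables, the bound variables are packed in front of the
  environment \<open>e\<close>, so that the premises are again about unary functions.
\<close>

lemma recursive_rec_nat [recursive_intros]:
  fixes b :: "'e::encodable \<Rightarrow> 'a::encodable"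
  assumes b: "recursive b" and s: "recursive (\<lambda>p. s (fst p) (fst (snd p)) (snd (snd p)))"
    and c: "recursive c"
  shows "recursive (\<lambda>e. rec_nat (b e) (\<lambda>n r. s n r e) (c e))"
proof -
  obtain gb where gb: "tracks gb b"
    using b unfolding recursive_def by blast
  obtain gs where gs: "tracks gs (\<lambda>p. s (fst p) (fst (snd p)) (snd (snd p)))"
    using s unfolding recursive_def by blast
  obtain gc where gc: "tracks gc c"
    using c unfolding recursive_def by blast
  let ?g = "\<lambda>z. rec_nat (gb z) (\<lambda>y r. gs (prod_encode (y, prod_encode (r, z)))) (gc z)"
  have "rec_nat (gb (encode e)) (\<lambda>y r. gs (prod_encode (y, prod_encode (r, encode e)))) n =
      encode (rec_nat (b e) (\<lambda>n r. s n r e) n)" for e n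
  proof (induction n)
    case (Suc n)
    then show ?case
      using tracks_encode[OF gs, of "(n, rec_nat (b e) (\<lambda>n r. s n r e) n, e)"]
      by (simp add: encode_prod_def encode_nat_def)
  qed (simp add: tracks_encode[OF gb])
  then have "?g (encode e) = encode (rec_nat (b e) (\<lambda>n r. s n r e) (c e))" for e
    by (simp add: tracks_encode[OF gc]) (simp add: encode_nat_def)
  moreover have "total_recursive 1 (\<lambda>xs. ?g (xs ! 0))"
    by (intro total_recursive_rec_nat total_recursive_tracks[OF gb] total_recursive_tracks[OF gs]
        total_recursive_tracks[OF gc] total_recursive_prod_encode
        total_recursive_proj total_recursive_drop[of 1 "\<lambda>xs. xs ! 0"]) auto
  ultimately show ?thesis
    by (intro recursiveI)
qed

lemma recursive_binary:
  fixes op :: "nat \<Rightarrow> nat \<Rightarrow> nat"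
  assumes "total_recursive2 op" "recursive f" "recursive f'"
  shows "recursive (\<lambda>x. op (f x) (f' x))"
proof -
  obtain g where g: "tracks g f"
    using assms(2) unfolding recursive_def by blast
  obtain g' where g': "tracks g' f'"
    using assms(3) unfolding recursive_def by blast
  show ?thesis
    by (rule recursiveI[of "\<lambda>x. op (g x) (g' x)"])
      (auto simp: tracks_encode[OF g] tracks_encode[OF g'] encode_nat_def
        intro!: total_recursive_tracks[OF g] total_recursive_tracks[OF g']
        total_recursive_app2[OF assms(1)] total_recursive_proj)
qed

lemma recursive_arith [recursive_intros]:
  fixes f g :: "'a::encodable \<Rightarrow> nat"
  assumes "recursive f" "recursive g"
  shows recursive_plus: "recursive (\<lambda>x. f x + g x)"
    and recursive_times: "recursive (\<lambda>x. f x * g x)"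
    and recursive_minus: "recursive (\<lambda>x. f x - g x)"
  by (rule recursive_binary[OF _ assms];
      intro total_recursive_plus total_recursive_times total_recursive_minus total_recursive_proj;
      simp)+

lemma recursive_Suc [recursive_intros]: "recursive f \<Longrightarrow> recursive (\<lambda>x. Suc (f x))"
  using recursive_plus[OF _ recursive_const, of f 1] by simp

lemma recursive_If [recursive_intros]:
  fixes f :: "'a::encodable \<Rightarrow> 'b::encodable"
  assumes "recursive P" "recursive f" "recursive g"
  shows "recursive (\<lambda>x. if P x then f x else g x)"
proof -
  \<comment> \<open>A truth value has code 0 or 1. As a number of iterations it keeps the else-value
    or replaces it once by the then-value.\<close>
  have "recursive (\<lambda>x. rec_nat (g x) (\<lambda>_ _. f x) (encode (P x)))"
    by (intro recursive_rec_nat recursive_encode recursive_comp[OF assms(2)] recursive_intros assms)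
  moreover have "rec_nat (g x) (\<lambda>_ _. f x) (encode (P x)) = (if P x then f x else g x)" for x
    by (simp add: encode_bool_def)
  ultimately show ?thesis by simp
qed

lemma recursive_conj [recursive_intros]:
  assumes "recursive P" "recursive Q"
  shows "recursive (\<lambda>x. P x \<and> Q x)"
proof -
  have "(\<lambda>x. P x \<and> Q x) = (\<lambda>x. if P x then Q x else False)" by auto
  then show ?thesis using recursive_If[OF assms recursive_const[of False]] by simp
qed

lemma recursive_Not [recursive_intros]: "recursive P \<Longrightarrow> recursive (\<lambda>x. \<not> P x)"
proof -
  assume "recursive P"
  moreover have "(\<lambda>x. \<not> P x) = (\<lambda>x. if P x then False else True)" by auto
  ultimately show ?thesis
    by (simp only:) (intro recursive_If recursive_const)
qed

lemma recursive_imp [recursive_intros]: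
  assumes "recursive P" "recursive Q"
  shows "recursive (\<lambda>x. P x \<longrightarrow> Q x)"
  using recursive_Not[OF recursive_conj[OF assms(1) recursive_Not[OF assms(2)]]] by simp

lemma recursive_eq [recursive_intros]:
  fixes f :: "'a::encodable \<Rightarrow> 'b::encodable"
  assumes "recursive f" "recursive g"
  shows "recursive (\<lambda>x. f x = g x)"
proof -
  \<comment> \<open>Both truncated differences vanish exactly when the codes agree.\<close>
  let ?d = "\<lambda>x. (encode (f x) - encode (g x)) + (encode (g x) - encode (f x))"
  have "recursive (\<lambda>x. rec_nat True (\<lambda>_ _. False) (?d x))"
    by (rule recursive_rec_nat; intro recursive_intros assms)
  moreover have "rec_nat True (\<lambda>_ _. False) (?d x) \<longleftrightarrow> ?d x = 0" for x
    by (cases "?d x") auto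
  moreover have "?d x = 0 \<longleftrightarrow> f x = g x" for x
    using encode_eq_iff[of "f x" "g x"] by (auto simp del: encode_eq_iff)
  ultimately show ?thesis by simp
qed

lemma recursive_less [recursive_intros]:
  fixes f g :: "'a::encodable \<Rightarrow> nat"
  assumes "recursive f" "recursive g"
  shows "recursive (\<lambda>x. f x < g x)"
proof -
  have "recursive (\<lambda>x. \<not> g x - f x = 0)"
    by (intro recursive_intros assms)
  then show ?thesis by (simp add: not_le)
qed

lemma recursive_Cons [recursive_intros]:
  assumes "recursive f" "recursive f'"
  shows "recursive (\<lambda>x. f x # f' x)"
proof -
  have "recursive (\<lambda>x. Suc (encode (f x, f' x)))"
    by (intro recursive_intros assms)
  then show ?thesis
    unfolding recursive_def tracks_def by (simp add: encode_prod_def encode_Cons encode_nat_def)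
qed

text \<open>The empty list has code 0, and a nonempty one has code \<open>Suc y\<close> where
  \<open>y\<close> pairs the codes of head and tail. A recursion whose step reads \<open>y\<close>
  and ignores the recursive value is thus the case distinction.\<close>

lemma recursive_case_list [recursive_intros]:
  fixes l :: "'e::encodable \<Rightarrow> 'a::encodable list" and b :: "'e \<Rightarrow> 'b::encodable"
  assumes l: "recursive l" and b: "recursive b"
    and s: "recursive (\<lambda>p. s (fst p) (fst (snd p)) (snd (snd p)))"
  shows "recursive (\<lambda>e. case l e of [] \<Rightarrow> b e | x # xs \<Rightarrow> s x xs e)"
proof -
  obtain gb where gb: "tracks gb b"
    using b unfolding recursive_def by blast
  obtain gs where gs: "tracks gs (\<lambda>p. s (fst p) (fst (snd p)) (snd (snd p)))"
    using s unfolding recursive_def by blast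
  obtain gl where gl: "tracks gl l"
    using l unfolding recursive_def by blast
  let ?s = "\<lambda>y z. gs (prod_encode (fst (prod_decode y), prod_encode (snd (prod_decode y), z)))"
  let ?g = "\<lambda>z. rec_nat (gb z) (\<lambda>y r. ?s y z) (gl z)"
  have "?g (encode e) = encode (case l e of [] \<Rightarrow> b e | x # xs \<Rightarrow> s x xs e)" for e
  proof (cases "l e")
    case (Cons x xs)
    then show ?thesis
      using tracks_encode[OF gs, of "(x, xs, e)"] by (simp add: encode_prod_def tracks_encode[OF gl] encode_Cons)
  qed (simp add: tracks_encode[OF gb] tracks_encode[OF gl] encode_Nil)
  moreover have "total_recursive 1 (\<lambda>xs. ?g (xs ! 0))"
    by (intro total_recursive_rec_nat total_recursive_tracks[OF gb] total_recursive_tracks[OF gs]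
        total_recursive_tracks[OF gl] total_recursive_prod_encode
        total_recursive_prod_decode total_recursive_proj
        total_recursive_drop[of 1 "\<lambda>xs. xs ! 0"]) auto
  ultimately show ?thesis
    by (intro recursiveI)
qed

lemma length_le_list_encode: "length xs \<le> list_encode xs"
  by (induction xs) (auto intro: le_trans le_prod_encode_2)

lemma length_le_encode: "length xs \<le> encode xs"
  using length_le_list_encode[of "map encode xs"] by (simp add: encode_list_def)

text \<open>
  Since the code of a list bounds its length, running the fold for as many steps as the code
  says reaches the end of the list.
\<close>

lemma recursive_foldl [recursive_intros]:
  fixes l :: "'e::encodable \<Rightarrow> 'a::encodable list" and b :: "'e \<Rightarrow> 'b::encodable"
  assumes l: "recursive l" and b: "recursive b"
    and s: "recursive (\<lambda>p. s (fst p) (fst (snd p)) (snd (snd p)))"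
  shows "recursive (\<lambda>e. foldl (\<lambda>r x. s r x e) (b e) (l e))"
proof -
  \<comment> \<open>The state pairs the accumulator with the unread rest of the list; once the rest
    is empty, surplus iterations change nothing.\<close>
  let ?step = "\<lambda>e r. case snd r of [] \<Rightarrow> r | x # xs \<Rightarrow> (s (fst r) x e, xs)"
  have s': "recursive (\<lambda>p. s (u p) (v p) (w p))"
    if "recursive u" "recursive v" "recursive w"
    for u w and v :: "'c::encodable \<Rightarrow> 'a"
    using recursive_comp[OF s recursive_Pair[OF that(1) recursive_Pair[OF that(2,3)]]] by simp
  have "recursive (\<lambda>e. fst (rec_nat (b e, l e) (\<lambda>_ r. ?step e r) (encode (l e))))"
    by (intro recursive_intros recursive_rec_nat[where s = "\<lambda>_ r e. ?step e r"]
        recursive_case_list l b s')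
  moreover have "rec_nat (r, xs) (\<lambda>_ r. ?step e r) n = (foldl (\<lambda>r x. s r x e) r xs, [])"
    if "length xs \<le> n" for e r xs n
  proof -
    have "rec_nat (r, xs) (\<lambda>_ r. ?step e r) n =
        (foldl (\<lambda>r x. s r x e) r (take n xs), drop n xs)"
    proof (induction n)
      case (Suc n)
      show ?case
      proof (cases "n < length xs")
        case True
        then show ?thesis
          using Suc by (simp add: take_Suc_conv_app_nth Cons_nth_drop_Suc[symmetric])
      qed (use Suc in simp)
    qed simp
    then show ?thesis using that by simp
  qed
  ultimately show ?thesis by (simp add: length_le_encode)
qed

lemma recursive_rev [recursive_intros]:
  assumes "recursive l"
  shows "recursive (\<lambda>e. rev (l e))"
proof -
  have "recursive (\<lambda>e. foldl (\<lambda>r x. x # r) [] (l e))"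
    by (intro recursive_foldl[where s = "\<lambda>r x _. x # r"] recursive_intros assms)
  moreover have "foldl (\<lambda>r x. x # r) ys xs = rev xs @ ys" for xs ys :: "'b list"
    by (induction xs arbitrary: ys) auto
  ultimately show ?thesis by simp
qed

lemma recursive_foldr [recursive_intros]:
  fixes l :: "'e::encodable \<Rightarrow> 'a::encodable list" and b :: "'e \<Rightarrow> 'b::encodable"
  assumes "recursive l" "recursive b"
    and s: "recursive (\<lambda>p. s (fst p) (fst (snd p)) (snd (snd p)))"
  shows "recursive (\<lambda>e. foldr (\<lambda>x r. s x r e) (l e) (b e))"
proof -
  have "recursive (\<lambda>p. s (fst (snd p)) (fst p) (snd (snd p)))"
    using recursive_comp[OF s, of "\<lambda>p. (fst (snd p), fst p, snd (snd p))"]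
    by (simp add: recursive_intros)
  then show ?thesis
    unfolding foldr_conv_foldl by (intro recursive_intros assms)
qed

section \<open>Recursive list functions\<close>

lemma recursive_map [recursive_intros]:
  fixes l :: "'e::encodable \<Rightarrow> 'a::encodable list" and f :: "'a \<Rightarrow> 'e \<Rightarrow> 'c::encodable"
  assumes "recursive l" "recursive (\<lambda>p. f (fst p) (snd p))"
  shows "recursive (\<lambda>e. map (\<lambda>x. f x e) (l e))"
proof -
  have f: "recursive (\<lambda>p. f (u p) (v p))" if "recursive u" "recursive v" for u v
    using recursive_comp[OF assms(2) recursive_Pair[OF that]] by simp
  have "recursive (\<lambda>e. foldr (\<lambda>x r. f x e # r) (l e) [])"
    by (intro recursive_intros f assms(1))
  moreover have "foldr (\<lambda>x r. g x # r) xs [] = map g xs" for g :: "'a \<Rightarrow> 'c" and xs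
    by (induction xs) auto
  ultimately show ?thesis by simp
qed

lemma recursive_append [recursive_intros]:
  assumes "recursive l" "recursive l'"
  shows "recursive (\<lambda>e. l e @ l' e)"
proof -
  have "recursive (\<lambda>e. foldr (\<lambda>x r. x # r) (l e) (l' e))"
    by (intro recursive_intros assms)
  moreover have "foldr (\<lambda>x r. x # r) xs ys = xs @ ys" for xs ys :: "'b list"
    by (induction xs) auto
  ultimately show ?thesis by simp
qed

lemma recursive_concat [recursive_intros]:
  assumes "recursive l"
  shows "recursive (\<lambda>e. concat (l e))"
proof -
  have "recursive (\<lambda>e. foldr (\<lambda>x r. x @ r) (l e) [])"
    by (intro recursive_intros assms)
  moreover have "foldr (\<lambda>x r. x @ r) xs [] = concat xs" for xs :: "'b list list"
    by (induction xs) auto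
  ultimately show ?thesis by simp
qed

lemma recursive_filter [recursive_intros]:
  fixes l :: "'e::encodable \<Rightarrow> 'a::encodable list" and P :: "'a \<Rightarrow> 'e \<Rightarrow> bool"
  assumes "recursive l" "recursive (\<lambda>p. P (fst p) (snd p))"
  shows "recursive (\<lambda>e. filter (\<lambda>x. P x e) (l e))"
proof -
  have P: "recursive (\<lambda>p. P (u p) (v p))" if "recursive u" "recursive v" for u v
    using recursive_comp[OF assms(2) recursive_Pair[OF that]] by simp
  have "recursive (\<lambda>e. foldr (\<lambda>x r. if P x e then x # r else r) (l e) [])"
    by (intro recursive_intros P assms(1))
  moreover have "foldr (\<lambda>x r. if Q x then x # r else r) xs [] = filter Q xs" for Q :: "'a \<Rightarrow> bool" and xs
    by (induction xs) auto
  ultimately show ?thesis by simp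
qed

lemma recursive_takeWhile [recursive_intros]:
  fixes l :: "'e::encodable \<Rightarrow> 'a::encodable list" and P :: "'a \<Rightarrow> 'e \<Rightarrow> bool"
  assumes "recursive l" "recursive (\<lambda>p. P (fst p) (snd p))"
  shows "recursive (\<lambda>e. takeWhile (\<lambda>x. P x e) (l e))"
proof -
  have P: "recursive (\<lambda>p. P (u p) (v p))" if "recursive u" "recursive v" for u v
    using recursive_comp[OF assms(2) recursive_Pair[OF that]] by simp
  have "recursive (\<lambda>e. foldr (\<lambda>x r. if P x e then x # r else []) (l e) [])"
    by (intro recursive_intros P assms(1))
  moreover have "foldr (\<lambda>x r. if Q x then x # r else []) xs [] = takeWhile Q xs"
    for Q :: "'a \<Rightarrow> bool" and xs
    by (induction xs) auto
  ultimately show ?thesis by simp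
qed

lemma recursive_Ball_set [recursive_intros]:
  fixes l :: "'e::encodable \<Rightarrow> 'a::encodable list" and P :: "'a \<Rightarrow> 'e \<Rightarrow> bool"
  assumes "recursive l" "recursive (\<lambda>p. P (fst p) (snd p))"
  shows "recursive (\<lambda>e. \<forall>x\<in>set (l e). P x e)"
proof -
  have P: "recursive (\<lambda>p. P (u p) (v p))" if "recursive u" "recursive v" for u v
    using recursive_comp[OF assms(2) recursive_Pair[OF that]] by simp
  have "recursive (\<lambda>e. foldr (\<lambda>x r. P x e \<and> r) (l e) True)"
    by (intro recursive_intros P assms(1))
  moreover have "foldr (\<lambda>x r. Q x \<and> r) xs True \<longleftrightarrow> (\<forall>x\<in>set xs. Q x)" for Q :: "'a \<Rightarrow> bool" and xs
    by (induction xs) auto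
  ultimately show ?thesis by simp
qed

lemma recursive_member [recursive_intros]:
  fixes f :: "'e::encodable \<Rightarrow> 'a::encodable"
  assumes "recursive f" "recursive l"
  shows "recursive (\<lambda>e. f e \<in> set (l e))"
proof -
  have f: "recursive (\<lambda>p. f (u p))" if "recursive u" for u
    using recursive_comp[OF assms(1) that] .
  have "recursive (\<lambda>e. \<not> (\<forall>x\<in>set (l e). \<not> x = f e))"
    by (intro recursive_intros f assms(2))
  moreover have "\<not> (\<forall>x\<in>set (l e). \<not> x = f e) \<longleftrightarrow> f e \<in> set (l e)" for e
    by auto
  ultimately show ?thesis by simp
qed

lemma recursive_remdups [recursive_intros]:
  assumes "recursive l"
  shows "recursive (\<lambda>e. remdups (l e))"
proof -
  have "recursive (\<lambda>e. foldr (\<lambda>x r. if x \<in> set r then r else x # r) (l e) [])"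
    by (intro recursive_intros assms)
  moreover have "foldr (\<lambda>x r. if x \<in> set r then r else x # r) xs [] = remdups xs" for xs :: "'b list"
    by (induction xs) auto
  ultimately show ?thesis by simp
qed

lemma recursive_length [recursive_intros]:
  assumes "recursive l"
  shows "recursive (\<lambda>e. length (l e))"
proof -
  have "recursive (\<lambda>e. foldr (\<lambda>x r. Suc r) (l e) 0)"
    by (intro recursive_intros assms)
  moreover have "foldr (\<lambda>x r. Suc r) xs 0 = length xs" for xs :: "'b list"
    by (induction xs) auto
  ultimately show ?thesis by simp
qed

lemma recursive_sum_list [recursive_intros]:
  fixes l :: "'e::encodable \<Rightarrow> nat list"
  assumes "recursive l"
  shows "recursive (\<lambda>e. sum_list (l e))"
proof -
  have "recursive (\<lambda>e. foldr (\<lambda>x r. x + r) (l e) 0)"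
    by (intro recursive_intros assms)
  moreover have "foldr (\<lambda>x r. x + r) xs 0 = sum_list xs" for xs :: "nat list"
    by (induction xs) auto
  ultimately show ?thesis by simp
qed

lemma recursive_count_list [recursive_intros]:
  assumes "recursive l" "recursive f"
  shows "recursive (\<lambda>e. count_list (l e) (f e))"
proof -
  have f: "recursive (\<lambda>p. f (u p))" if "recursive u" for u
    using recursive_comp[OF assms(2) that] .
  have "recursive (\<lambda>e. length (filter (\<lambda>x. x = f e) (l e)))"
    by (intro recursive_intros f assms(1))
  moreover have "length (filter (\<lambda>x. x = y) xs) = count_list xs y" for xs :: "'b list" and y
    by (induction xs) auto
  ultimately show ?thesis by simp
qed

lemma recursive_upt [recursive_intros]:
  assumes "recursive f"
  shows "recursive (\<lambda>e. [0..<f e])"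
proof -
  have "recursive (\<lambda>e. rec_nat [] (\<lambda>i r. r @ [i]) (f e))"
    by (intro recursive_intros assms)
  moreover have "rec_nat [] (\<lambda>i r. r @ [i]) n = [0..<n]" for n
    by (induction n) auto
  ultimately show ?thesis by simp
qed

lemma recursive_drop [recursive_intros]:
  assumes "recursive f" "recursive l"
  shows "recursive (\<lambda>e. drop (f e) (l e))"
proof -
  have "recursive (\<lambda>e. rec_nat (l e) (\<lambda>_ r. case r of [] \<Rightarrow> [] | x # xs \<Rightarrow> xs) (f e))"
    by (intro recursive_intros assms)
  moreover have "(case r of [] \<Rightarrow> [] | x # xs \<Rightarrow> xs) = tl r" for r :: "'b list"
    by (cases r) auto
  moreover have "rec_nat xs (\<lambda>_ r. tl r) n = drop n xs" for xs :: "'b list" and n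
    by (induction n) (simp_all add: drop_Suc tl_drop)
  ultimately show ?thesis by simp
qed

lemma recursive_take [recursive_intros]:
  assumes "recursive f" "recursive l"
  shows "recursive (\<lambda>e. take (f e) (l e))"
proof -
  have "recursive (\<lambda>e. rev (drop (length (l e) - f e) (rev (l e))))"
    by (intro recursive_intros assms)
  moreover have "rev (drop (length xs - n) (rev xs)) = take n xs" for xs :: "'b list" and n
    by (cases "n \<le> length xs") (simp_all add: rev_drop)
  ultimately show ?thesis by simp
qed

lemma recursive_product [recursive_intros]:
  assumes "recursive l" "recursive l'"
  shows "recursive (\<lambda>e. List.product (l e) (l' e))"
proof -
  have l': "recursive (\<lambda>p. l' (u p))" if "recursive u" for u
    using recursive_comp[OF assms(2) that] .
  have "recursive (\<lambda>e. concat (map (\<lambda>x. map (\<lambda>y. (x, y)) (l' e)) (l e)))"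
    by (intro recursive_intros l' assms(1))
  then show ?thesis by (simp add: product_concat_map)
qed

lemma recursive_subseqs [recursive_intros]:
  assumes "recursive l"
  shows "recursive (\<lambda>e. subseqs (l e))"
proof -
  have "recursive (\<lambda>e. foldr (\<lambda>x r. map (\<lambda>y. x # y) r @ r) (l e) [[]])"
    by (intro recursive_intros assms)
  moreover have "foldr (\<lambda>x r. map (\<lambda>y. x # y) r @ r) xs [[]] = subseqs xs" for xs :: "'b list"
    by (induction xs) (auto simp: Let_def)
  ultimately show ?thesis by simp
qed

text \<open>The default for positions beyond the end makes list access a plain case distinction,
  hence recursive.\<close>

definition nth_or :: "'a \<Rightarrow> 'a list \<Rightarrow> nat \<Rightarrow> 'a" where
  "nth_or y xs n = (case drop n xs of [] \<Rightarrow> y | x # _ \<Rightarrow> x)"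

lemma nth_or_eq_nth: "n < length xs \<Longrightarrow> nth_or y xs n = xs ! n"
  by (simp add: nth_or_def Cons_nth_drop_Suc[symmetric])

lemma recursive_nth_or [recursive_intros]:
  assumes "recursive y" "recursive l" "recursive f"
  shows "recursive (\<lambda>e. nth_or (y e) (l e) (f e))"
  unfolding nth_or_def by (intro recursive_intros assms)

section \<open>Computation of the automaton\<close>

type_synonym table = "(nat \<times> nat list) list"
type_synonym node = "nat \<times> nat"

definition letter_image :: "table \<Rightarrow> nat \<Rightarrow> nat list" where
  "letter_image t b = concat (map snd (filter (\<lambda>p. fst p = b) t))"

definition table_trace :: "table \<Rightarrow> nat" where
  "table_trace t = sum_list (map (\<lambda>p. count_list (snd p) (fst p)) t)"

text \<open>
  A node \<open>(b, p)\<close> stands for the \<open>p\<close>-th position inside the block \<open>\<phi>(b)\<close>; the nodes of \<open>w\<close>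
  label the positions of \<open>\<phi>(w)\<close>.
\<close>

definition nodes :: "table \<Rightarrow> nat list \<Rightarrow> node list" where
  "nodes t w = concat (map (\<lambda>b. map (\<lambda>p. (b, p)) [0..<length (letter_image t b)]) w)"

text \<open>The labels of \<open>\<phi>(\<phi>(b))\<close> split into \<open>|\<phi>(b)|\<close>
  blocks of length \<open>k\<close>. The block with index \<open>p\<close> is the image of the node
  \<open>(b, p)\<close> under the \<open>k\<close>-uniform morphism, and \<open>d\<close> selects a
  letter of it.\<close>

definition child :: "table \<Rightarrow> node \<Rightarrow> nat \<Rightarrow> node" where
  "child t u d = nth_or (0, 0) (nodes t (letter_image t (fst u))) (table_trace t * snd u + d)"

text \<open>Access to the concatenated images of two neighbouring nodes, for offsets below
  \<open>2 * k\<close> that may carry into the second one.\<close>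

definition child2 :: "table \<Rightarrow> node \<Rightarrow> node \<Rightarrow> nat \<Rightarrow> node" where
  "child2 t u v e = (if e < table_trace t then child t u e else child t v (e - table_trace t))"

text \<open>The digit \<open>e\<close> extends the start position and \<open>d\<close> the window
  length, so the end position receives the offset \<open>e + d\<close>. The possible carry is why a
  triple records two adjacent nodes at the end of the window.\<close>

definition successor :: "table \<Rightarrow> nat \<Rightarrow> nat \<Rightarrow> node \<times> node \<times> node \<Rightarrow> node \<times> node \<times> node" where
  "successor t d e T =
     (child t (fst T) e,
      child2 t (fst (snd T)) (snd (snd T)) (e + d),
      child2 t (fst (snd T)) (snd (snd T)) (Suc (e + d)))"

definition step :: "table \<Rightarrow> nat \<Rightarrow> (node \<times> node \<times> node) list \<Rightarrow> (node \<times> node \<times> node) list" where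
  "step t d S = concat (map (\<lambda>T. map (\<lambda>e. successor t d e T) [0..<table_trace t]) S)"

definition triples :: "table \<Rightarrow> (node \<times> node \<times> node) list" where
  "triples t = (let U = nodes t (map fst t) in List.product U (List.product U U))"

definition root :: "table \<Rightarrow> nat \<Rightarrow> node \<times> node \<times> node" where
  "root t a = ((a, 0), (a, 0), child t (a, 0) 1)"

definition states :: "table \<Rightarrow> (node \<times> node \<times> node) list list" where
  "states t = subseqs (triples t)"

definition initial :: "table \<Rightarrow> nat \<Rightarrow> (node \<times> node \<times> node) list" where
  "initial t a =
     filter (\<lambda>T. \<forall>S\<in>set (states t).
       root t a \<in> set S \<and> (\<forall>T'\<in>set (step t 0 S). T' \<in> set S) \<longrightarrow> T \<in> set S) (triples t)"

text \<open>States stand for sets, but \<open>step\<close> may return their elements repeated or in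
  another order; hence the search compares elements only.\<close>

definition state_index :: "table \<Rightarrow> (node \<times> node \<times> node) list \<Rightarrow> nat" where
  "state_index t S =
     length (takeWhile (\<lambda>S'. \<not> ((\<forall>T\<in>set S. T \<in> set S') \<and> (\<forall>T\<in>set S'. T \<in> set S))) (states t))"

text \<open>The pair of truncated differences encodes an integer.\<close>

definition node_diff :: "table \<Rightarrow> nat \<Rightarrow> node \<Rightarrow> node \<Rightarrow> nat \<times> nat" where
  "node_diff t a u v =
     (let A = length (letter_image t a); B = sum_list (letter_image t a);
          p = A * sum_list (take (snd v) (letter_image t (fst v))) + B * snd u;
          q = A * sum_list (take (snd u) (letter_image t (fst u))) + B * snd v
      in (p - q, q - p))"

definition diff_count :: "table \<Rightarrow> nat \<Rightarrow> (node \<times> node \<times> node) list \<Rightarrow> nat" where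
  "diff_count t a S = length (remdups (map (\<lambda>T. node_diff t a (fst T) (fst (snd T))) S))"

definition automaton :: "table \<Rightarrow> nat \<Rightarrow> dfao" where
  "automaton t a =
     DFAO (state_index t (initial t a))
       (map (\<lambda>S. map (\<lambda>d. state_index t (step t d S)) [0..<table_trace t]) (states t))
       (map (\<lambda>S. diff_count t a S) (states t))"

section \<open>Recursiveness of the automaton program\<close>

lemma recursive_letter_image [recursive_intros]:
  assumes "recursive t" "recursive b"
  shows "recursive (\<lambda>x. letter_image (t x) (b x))"
  unfolding letter_image_def
  by (intro recursive_comp[OF assms(1)] recursive_comp[OF assms(2)] recursive_intros)

lemma recursive_table_trace [recursive_intros]:
  assumes "recursive t"
  shows "recursive (\<lambda>x. table_trace (t x))"
  unfolding table_trace_def by (intro recursive_comp[OF assms] recursive_intros)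

lemma recursive_nodes [recursive_intros]:
  assumes "recursive t" "recursive w"
  shows "recursive (\<lambda>x. nodes (t x) (w x))"
  unfolding nodes_def
  by (intro recursive_comp[OF assms(1)] recursive_comp[OF assms(2)] recursive_intros)

lemma recursive_child [recursive_intros]:
  assumes "recursive t" "recursive u" "recursive d"
  shows "recursive (\<lambda>x. child (t x) (u x) (d x))"
  unfolding child_def by (intro assms recursive_intros)

lemma recursive_child2 [recursive_intros]:
  assumes "recursive t" "recursive u" "recursive v" "recursive d"
  shows "recursive (\<lambda>x. child2 (t x) (u x) (v x) (d x))"
  unfolding child2_def by (intro assms recursive_intros)

lemma recursive_successor [recursive_intros]:
  assumes "recursive t" "recursive d" "recursive e" "recursive T"
  shows "recursive (\<lambda>x. successor (t x) (d x) (e x) (T x))"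
  unfolding successor_def by (intro assms recursive_intros)

lemma recursive_step [recursive_intros]:
  assumes "recursive t" "recursive d" "recursive S"
  shows "recursive (\<lambda>x. step (t x) (d x) (S x))"
  unfolding step_def
  by (intro recursive_comp[OF assms(1)] recursive_comp[OF assms(2)] recursive_comp[OF assms(3)]
      recursive_intros)

lemma recursive_triples [recursive_intros]:
  assumes "recursive t"
  shows "recursive (\<lambda>x. triples (t x))"
  unfolding triples_def Let_def by (intro recursive_comp[OF assms] recursive_intros)

lemma recursive_root [recursive_intros]:
  assumes "recursive t" "recursive a"
  shows "recursive (\<lambda>x. root (t x) (a x))"
  unfolding root_def by (intro assms recursive_intros)

lemma recursive_states [recursive_intros]:
  assumes "recursive t"
  shows "recursive (\<lambda>x. states (t x))"
  unfolding states_def by (intro assms recursive_intros)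

lemma recursive_initial [recursive_intros]:
  assumes "recursive t" "recursive a"
  shows "recursive (\<lambda>x. initial (t x) (a x))"
  unfolding initial_def
  by (intro recursive_comp[OF assms(1)] recursive_comp[OF assms(2)] recursive_intros)

lemma recursive_state_index [recursive_intros]:
  assumes "recursive t" "recursive S"
  shows "recursive (\<lambda>x. state_index (t x) (S x))"
  unfolding state_index_def
  by (intro recursive_comp[OF assms(1)] recursive_comp[OF assms(2)] recursive_intros)

lemma recursive_node_diff [recursive_intros]:
  assumes "recursive t" "recursive a" "recursive u" "recursive v"
  shows "recursive (\<lambda>x. node_diff (t x) (a x) (u x) (v x))"
  unfolding node_diff_def Let_def by (intro assms recursive_intros)

lemma recursive_diff_count [recursive_intros]:
  assumes "recursive t" "recursive a" "recursive S"
  shows "recursive (\<lambda>x. diff_count (t x) (a x) (S x))"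
  unfolding diff_count_def
  by (intro recursive_comp[OF assms(1)] recursive_comp[OF assms(2)] recursive_comp[OF assms(3)]
      recursive_intros)

text \<open>The nested tuple of the three fields has exactly the code that
  \<open>encode_dfao\<close> assigns to the automaton.\<close>

lemma recursive_automaton:
  "recursive (\<lambda>x. let M = automaton (fst x) (snd x) in (init M, trans M, out M))"
  unfolding automaton_def Let_def dfao.sel by (intro recursive_intros)

lemma encode_nat_list: "encode = (list_encode :: nat list \<Rightarrow> nat)"
  by (simp add: encode_list_def[abs_def] encode_nat_def[abs_def])

lemma computable_automaton:
  "\<exists>F. computable F \<and>
     (\<forall>t a. F (prod_encode (list_encode (map (\<lambda>(b, w). prod_encode (b, list_encode w)) t), a)) =
       Some (encode_dfao (automaton t a)))"
proof -
  obtain g where g: "total_recursive1 g"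
    and g_encode: "\<And>x :: table \<times> nat. g (encode x) =
      encode (let M = automaton (fst x) (snd x) in (init M, trans M, out M))"
    using recursive_automaton unfolding recursive_def tracks_def by blast
  obtain f where f: "partial_recursive 1 f"
    and f_eq: "\<And>xs. length xs = 1 \<Longrightarrow> f xs = Some (g (xs ! 0))"
    using g unfolding total_recursive_def by blast
  have "computable (\<lambda>x. f [x])"
    using f unfolding computable_def by blast
  moreover have "f [encode (t, a)] = Some (encode_dfao (automaton t a))" for t :: table and a :: nat
    by (simp add: f_eq g_encode Let_def)
      (simp add: encode_dfao_def encode_prod_def encode_list_def encode_nat_list, simp add: encode_nat_def)
  moreover have "encode (t, a) =
      prod_encode (list_encode (map (\<lambda>(b, w). prod_encode (b, list_encode w)) t), a)"
    for t :: table and a :: nat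
    by (simp add: encode_prod_def[abs_def] encode_list_def encode_nat_list case_prod_unfold)
      (simp add: encode_nat_def)
  ultimately show ?thesis by metis
qed

section \<open>Parikh-collinear morphisms\<close>

lemma map_upt_split: "m \<le> n \<Longrightarrow> map f [0..<n] = map f [0..<m] @ map f [m..<n]"
  using upt_add_eq_append[of 0 m "n - m"] by (simp flip: map_append)

lemma filter_fst_map_Pair:
  "distinct xs \<Longrightarrow> b \<in> set xs \<Longrightarrow> filter (\<lambda>p. fst p = b) (map (\<lambda>b. (b, f b)) xs) = [(b, f b)]"
  by (induction xs) (auto simp: filter_empty_conv)

text \<open>Regrouping a word by letters turns lengths, letter sums and lengths of images into
  expressions in Parikh vectors, to which the minors apply.\<close>

lemma sum_list_eq_sum_count:
  assumes "finite A" "set w \<subseteq> A"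
  shows "sum_list (map f w) = (\<Sum>c\<in>A. count_list w c * f c)"
  using assms(2)
proof (induction w)
  case (Cons b w)
  have "(\<Sum>c\<in>A. count_list (b # w) c * f c) = (\<Sum>c\<in>A. count_list w c * f c) +
      (\<Sum>c\<in>A. if b = c then f c else 0)"
    by (subst sum.distrib[symmetric]) (rule sum.cong, auto)
  also have "(\<Sum>c\<in>A. if b = c then f c else 0) = f b"
    using Cons.prems assms(1) by simp
  finally show ?case using Cons by simp
qed simp

lemma collinear_on_minor:
  assumes "collinear_on A u v" "c \<in> A" "d \<in> A"
  shows "u c * v d = u d * v c"
proof -
  obtain r s :: rat where rs: "r \<noteq> 0 \<or> s \<noteq> 0" "\<And>c. c \<in> A \<Longrightarrow> r * of_nat (u c) = s * of_nat (v c)"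
    using assms(1) unfolding collinear_on_def by blast
  \<comment> \<open>Either coefficient may vanish, so the identity is derived once multiplied by
    \<open>r\<close> and once by \<open>s\<close>; the nonzero one cancels.\<close>
  have "r * (of_nat (u c) * of_nat (v d)) = r * (of_nat (u d) * of_nat (v c))"
    using rs(2)[OF assms(2)] rs(2)[OF assms(3)] by algebra
  moreover have "s * (of_nat (u c) * of_nat (v d)) = s * (of_nat (u d) * of_nat (v c))"
    using rs(2)[OF assms(2)] rs(2)[OF assms(3)] by algebra
  ultimately have "(of_nat (u c * v d) :: rat) = of_nat (u d * v c)"
    using rs(1) by auto
  then show ?thesis by (simp only: of_nat_eq_iff)
qed

definition morphism_table :: "nat set \<Rightarrow> (nat list \<Rightarrow> nat list) \<Rightarrow> table" where
  "morphism_table \<Sigma> \<phi> = map (\<lambda>b. (b, \<phi> [b])) (sorted_list_of_set \<Sigma>)"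

locale collinear_fixed_point =
  fixes \<Sigma> :: "nat set" and \<phi> :: "nat list \<Rightarrow> nat list" and a :: nat
  assumes admissible: "admissible \<Sigma> \<phi> a"
begin

abbreviation "t \<equiv> morphism_table \<Sigma> \<phi>"
abbreviation "k \<equiv> trace_morphism \<Sigma> \<phi>"
abbreviation "x \<equiv> fixed_point \<phi> a"

lemma finite_alphabet: "finite \<Sigma>"
  and morphism: "is_morphism \<Sigma> \<phi>"
  and collinear: "parikh_collinear \<Sigma> \<phi>"
  and a_in: "a \<in> \<Sigma>"
  and prolongable: "prolongable \<phi> a"
  using admissible unfolding admissible_def by auto

lemma image_in: "set w \<subseteq> \<Sigma> \<Longrightarrow> set (\<phi> w) \<subseteq> \<Sigma>"
  using morphism unfolding is_morphism_def by (auto simp: lists_eq_set)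

lemma image_append: "set v \<subseteq> \<Sigma> \<Longrightarrow> set w \<subseteq> \<Sigma> \<Longrightarrow> \<phi> (v @ w) = \<phi> v @ \<phi> w"
  using morphism unfolding is_morphism_def by (auto simp: lists_eq_set)

lemma image_Nil: "\<phi> [] = []"
  using image_append[of "[]" "[]"] by simp

lemma image_eq_concat: "set w \<subseteq> \<Sigma> \<Longrightarrow> \<phi> w = concat (map (\<lambda>b. \<phi> [b]) w)"
proof (induction w)
  case (Cons b w)
  then show ?case using image_append[of "[b]" w] by simp
qed (simp add: image_Nil)

lemma image_Cons: "b \<in> \<Sigma> \<Longrightarrow> set w \<subseteq> \<Sigma> \<Longrightarrow> \<phi> (b # w) = \<phi> [b] @ \<phi> w"
  using image_append[of "[b]" w] by simp

lemma letter_image: "b \<in> \<Sigma> \<Longrightarrow> letter_image t b = \<phi> [b]"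
  by (simp add: letter_image_def morphism_table_def filter_fst_map_Pair finite_alphabet)

lemma table_trace: "table_trace t = k"
  by (simp add: table_trace_def morphism_table_def trace_morphism_def comp_def
      sum.set_conv_list[symmetric] sum_list_distinct_conv_sum_set finite_alphabet)

lemma minor:
  assumes "b \<in> \<Sigma>" "b' \<in> \<Sigma>" "c \<in> \<Sigma>" "d \<in> \<Sigma>"
  shows "count_list (\<phi> [b]) c * count_list (\<phi> [b']) d = count_list (\<phi> [b]) d * count_list (\<phi> [b']) c"
  using collinear_on_minor[OF _ assms(3,4)] collinear assms(1,2)
  unfolding parikh_collinear_def parikh_def[abs_def] by blast

lemma length_letter_image:
  assumes "b \<in> \<Sigma>"
  shows "length (\<phi> [b]) = (\<Sum>c\<in>\<Sigma>. count_list (\<phi> [b]) c)"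
  using sum_list_eq_sum_count[OF finite_alphabet image_in, of "[b]" "\<lambda>_. 1"] assms
  by (simp add: sum_list_triv)

text \<open>A matrix \<open>M\<close> of rank at most 1 satisfies \<open>M * M = tr(M) * M\<close>.
  Concretely, the minor exchanges \<open>c\<close> and \<open>d\<close> so that the double sum
  factors into trace and length.\<close>

lemma length_image_image_letter:
  assumes "b \<in> \<Sigma>"
  shows "length (\<phi> (\<phi> [b])) = k * length (\<phi> [b])"
proof -
  have "length (\<phi> (\<phi> [b])) = sum_list (map (\<lambda>c. length (\<phi> [c])) (\<phi> [b]))"
    using image_in[of "[b]"] assms by (simp add: image_eq_concat[of "\<phi> [b]"] length_concat comp_def)
  also have "\<dots> = (\<Sum>c\<in>\<Sigma>. count_list (\<phi> [b]) c * length (\<phi> [c]))"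
    using image_in[of "[b]"] assms by (intro sum_list_eq_sum_count finite_alphabet) auto
  also have "\<dots> = (\<Sum>c\<in>\<Sigma>. \<Sum>d\<in>\<Sigma>. count_list (\<phi> [b]) c * count_list (\<phi> [c]) d)"
    by (intro sum.cong) (simp_all add: length_letter_image sum_distrib_left)
  also have "\<dots> = (\<Sum>c\<in>\<Sigma>. \<Sum>d\<in>\<Sigma>. count_list (\<phi> [b]) d * count_list (\<phi> [c]) c)"
    by (intro sum.cong minor refl assms)
  also have "\<dots> = k * length (\<phi> [b])"
    by (simp add: trace_morphism_def length_letter_image assms sum_product) (simp add: mult.commute)
  finally show ?thesis .
qed

lemma length_image_image:
  "set w \<subseteq> \<Sigma> \<Longrightarrow> length (\<phi> (\<phi> w)) = k * length (\<phi> w)"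
proof (induction w)
  case (Cons b w)
  then show ?case
    using image_in[of "[b]"] image_in[of w]
    by (simp add: image_Cons[of b w] image_append length_image_image_letter algebra_simps)
qed (simp add: image_Nil)

text \<open>The common mean letter of all blocks, cross-multiplied so that erased letters are
  covered. The minor moves the weight \<open>c\<close> from the block of \<open>b\<close> to that of
  \<open>a\<close>.\<close>

lemma sum_list_letter_image:
  assumes "b \<in> \<Sigma>"
  shows "length (\<phi> [a]) * sum_list (\<phi> [b]) = sum_list (\<phi> [a]) * length (\<phi> [b])"
proof -
  have eq: "sum_list (\<phi> [b]) = (\<Sum>c\<in>\<Sigma>. count_list (\<phi> [b]) c * c)" if "b \<in> \<Sigma>" for b
    using sum_list_eq_sum_count[OF finite_alphabet image_in, of "[b]" "\<lambda>c. c"] that by simp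
  have "length (\<phi> [a]) * sum_list (\<phi> [b]) =
      (\<Sum>d\<in>\<Sigma>. \<Sum>c\<in>\<Sigma>. (count_list (\<phi> [a]) d * count_list (\<phi> [b]) c) * c)"
    by (simp add: eq length_letter_image assms a_in sum_product mult.assoc)
  also have "\<dots> = (\<Sum>d\<in>\<Sigma>. \<Sum>c\<in>\<Sigma>. (count_list (\<phi> [a]) c * count_list (\<phi> [b]) d) * c)"
    using minor[OF a_in assms] by (intro sum.cong refl) simp
  also have "\<dots> = (\<Sum>c\<in>\<Sigma>. \<Sum>d\<in>\<Sigma>. (count_list (\<phi> [a]) c * count_list (\<phi> [b]) d) * c)"
    by (rule sum.swap)
  also have "\<dots> = sum_list (\<phi> [a]) * length (\<phi> [b])"
    by (simp add: eq length_letter_image assms a_in sum_product) (simp add: mult_ac)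
  finally show ?thesis .
qed

section \<open>The fixed point, its growth and its prefixes\<close>

lemma iterate_in: "set ((\<phi> ^^ n) [a]) \<subseteq> \<Sigma>"
  by (induction n) (auto simp: a_in dest: image_in)

lemma length_iterate_unbounded: "\<exists>n. N \<le> length ((\<phi> ^^ n) [a])"
  using prolongable unfolding prolongable_def filterlim_at_top eventually_sequentially by blast

text \<open>From the first iterate on, lengths are multiplied by \<open>k\<close>; with
  \<open>k \<le> 1\<close> they would stay bounded, against prolongability.\<close>

lemma trace_ge_2: "2 \<le> k"
proof (rule ccontr)
  assume "\<not> 2 \<le> k"
  \<comment> \<open>The count starts at the first iterate because the factor \<open>k\<close> is
    known only for words that are images.\<close>
  have "length ((\<phi> ^^ Suc n) [a]) \<le> length (\<phi> [a])" for n
  proof (induction n)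
    case (Suc n)
    have "length ((\<phi> ^^ Suc (Suc n)) [a]) = k * length ((\<phi> ^^ Suc n) [a])"
      using length_image_image[OF iterate_in[of n]] by simp
    also have "\<dots> \<le> length ((\<phi> ^^ Suc n) [a])"
      using \<open>\<not> 2 \<le> k\<close> by (cases "k = 0") auto
    finally show ?case using Suc by simp
  qed simp
  moreover have "length ((\<phi> ^^ 0) [a]) \<le> length (\<phi> [a])"
    using prolongable unfolding prolongable_def by (auto simp: prefix_def)
  ultimately have "length ((\<phi> ^^ n) [a]) \<le> length (\<phi> [a])" for n
    by (cases n) blast+
  with length_iterate_unbounded[of "Suc (length (\<phi> [a]))"] show False
    by (meson not_less_eq_eq)
qed

lemma iterate_eq: "(\<phi> ^^ n) [a] = map x [0..<length ((\<phi> ^^ n) [a])]"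
  by (rule nth_equalityI) (simp_all add: fixed_point_nth[OF morphism a_in prolongable])

lemma fixed_point_in: "x i \<in> \<Sigma>"
proof -
  obtain n where "Suc i \<le> length ((\<phi> ^^ n) [a])"
    using length_iterate_unbounded by blast
  then have "x i = (\<phi> ^^ n) [a] ! i"
    by (intro fixed_point_nth[OF morphism a_in prolongable]) auto
  with \<open>Suc i \<le> length ((\<phi> ^^ n) [a])\<close> show ?thesis
    using iterate_in[of n] by (metis Suc_le_lessD nth_mem subsetD)
qed

lemma prefix_in: "set (map x [i..<j]) \<subseteq> \<Sigma>"
  using fixed_point_in by auto

text \<open>The relation \<open>\<phi>(x) = x\<close> on prefixes. An iterate covering the prefix is
  a prefix of \<open>x\<close>, its image is the next iterate, and both are cut to the required
  length.\<close>

lemma image_prefix: "\<phi> (map x [0..<j]) = map x [0..<length (\<phi> (map x [0..<j]))]"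
proof -
  obtain n where n: "j \<le> length ((\<phi> ^^ n) [a])"
    using length_iterate_unbounded by blast
  let ?l = "length ((\<phi> ^^ n) [a])"
  have "map x [0..<length ((\<phi> ^^ Suc n) [a])] = (\<phi> ^^ Suc n) [a]"
    by (rule iterate_eq[symmetric])
  also have "\<dots> = \<phi> (map x [0..<?l])"
    by (simp flip: iterate_eq)
  also have "map x [0..<?l] = map x [0..<j] @ map x [j..<?l]"
    using n by (rule map_upt_split)
  also have "\<phi> \<dots> = \<phi> (map x [0..<j]) @ \<phi> (map x [j..<?l])"
    by (intro image_append prefix_in)
  finally have eq: "map x [0..<length ((\<phi> ^^ Suc n) [a])] =
      \<phi> (map x [0..<j]) @ \<phi> (map x [j..<?l])" .
  from arg_cong[OF this, of length]
  have "length (\<phi> (map x [0..<j])) \<le> length ((\<phi> ^^ Suc n) [a])" by simp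
  then show ?thesis
    using arg_cong[OF eq, of "take (length (\<phi> (map x [0..<j])))"] by (simp add: take_map)
qed

text \<open>Erased letters cannot stall the images of prefixes: the image of an iterate is the next
  iterate, which is at least as long.\<close>

lemma image_prefix_unbounded: "\<exists>j. i < length (\<phi> (map x [0..<j]))"
proof -
  obtain n where "Suc i \<le> length ((\<phi> ^^ n) [a])"
    using length_iterate_unbounded by blast
  also have "\<dots> \<le> length ((\<phi> ^^ Suc n) [a])"
    by (intro prefix_length_le prefix_iterates[OF morphism a_in prolongable]) simp
  also have "(\<phi> ^^ Suc n) [a] = \<phi> (map x [0..<length ((\<phi> ^^ n) [a])])"
    by (simp flip: iterate_eq)
  finally show ?thesis by (auto simp: Suc_le_eq)
qed

section \<open>Labels of positions\<close>

lemma nodes_Cons: "b \<in> \<Sigma> \<Longrightarrow> nodes t (b # w) = map (\<lambda>p. (b, p)) [0..<length (\<phi> [b])] @ nodes t w"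
  by (simp add: nodes_def letter_image)

lemma nodes_append: "nodes t (v @ w) = nodes t v @ nodes t w"
  by (simp add: nodes_def)

lemma length_nodes: "set w \<subseteq> \<Sigma> \<Longrightarrow> length (nodes t w) = length (\<phi> w)"
proof (induction w)
  case (Cons b w)
  then show ?case by (simp add: nodes_Cons image_Cons[of b w])
qed (simp add: nodes_def image_Nil)

definition valid_nodes :: "node set" where
  "valid_nodes = {(b, p). b \<in> \<Sigma> \<and> p < length (\<phi> [b])}"

lemma set_nodes_eq: "set (nodes t w) = {(b, p). b \<in> set w \<and> p < length (letter_image t b)}"
  by (auto simp: nodes_def)

lemma set_nodes: "set w \<subseteq> \<Sigma> \<Longrightarrow> set (nodes t w) \<subseteq> valid_nodes"
  by (auto simp: set_nodes_eq valid_nodes_def letter_image)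

lemma set_nodes_alphabet: "set (nodes t (map fst t)) = valid_nodes"
proof -
  have "set (map fst t) = \<Sigma>"
    by (simp add: morphism_table_def comp_def finite_alphabet)
  then show ?thesis
    by (auto simp: set_nodes_eq valid_nodes_def letter_image simp del: set_map)
qed

text \<open>As \<open>k * p + d < k * Suc p \<le> k * |\<phi>(b)| = |\<phi>(\<phi>(b))|\<close>, the
  default of \<open>nth_or\<close> is never returned for a valid node and a digit.\<close>

lemma child_eq_nth:
  assumes "b \<in> \<Sigma>" "p < length (\<phi> [b])" "d < k"
  shows "child t (b, p) d = nodes t (\<phi> [b]) ! (k * p + d)"
    and "k * p + d < length (nodes t (\<phi> [b]))"
proof -
  have "k * p + d < k * Suc p" using assms(3) by simp
  also have "\<dots> \<le> k * length (\<phi> [b])" using assms(2) by (intro mult_le_mono) auto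
  also have "\<dots> = length (nodes t (\<phi> [b]))"
    using assms(1) image_in[of "[b]"] by (simp add: length_nodes length_image_image_letter)
  finally show "k * p + d < length (nodes t (\<phi> [b]))" .
  then show "child t (b, p) d = nodes t (\<phi> [b]) ! (k * p + d)"
    by (simp add: child_def letter_image table_trace assms(1) nth_or_eq_nth)
qed

lemma child_valid: "u \<in> valid_nodes \<Longrightarrow> d < k \<Longrightarrow> child t u d \<in> valid_nodes"
proof -
  assume "u \<in> valid_nodes" "d < k"
  then obtain b p where u: "u = (b, p)" "b \<in> \<Sigma>" "p < length (\<phi> [b])"
    unfolding valid_nodes_def by blast
  have "child t u d \<in> set (nodes t (\<phi> [b]))"
    using child_eq_nth[OF u(2,3) \<open>d < k\<close>] u(1) by simp
  moreover have "set (nodes t (\<phi> [b])) \<subseteq> valid_nodes"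
    using u(2) by (intro set_nodes image_in) simp
  ultimately show ?thesis by blast
qed

text \<open>Although \<open>\<phi>\<close> need not be uniform, the labels are: skipping a first
  letter \<open>b\<close> shifts \<open>i\<close> by \<open>|\<phi>(b)|\<close> and the position in
  \<open>\<phi>(\<phi>(w))\<close> by \<open>k\<close> times as much.\<close>

lemma nodes_image_nth:
  "set w \<subseteq> \<Sigma> \<Longrightarrow> i < length (\<phi> w) \<Longrightarrow> d < k \<Longrightarrow>
     nodes t (\<phi> w) ! (k * i + d) = child t (nodes t w ! i) d"
proof (induction w arbitrary: i)
  case (Cons b w)
  then have b: "b \<in> \<Sigma>" "set w \<subseteq> \<Sigma>" by auto
  have b': "set (\<phi> [b]) \<subseteq> \<Sigma>" using image_in[of "[b]"] b by simp
  have len: "length (nodes t (\<phi> [b])) = k * length (\<phi> [b])"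
    using b' b by (simp add: length_nodes length_image_image_letter)
  have eq: "nodes t (\<phi> (b # w)) = nodes t (\<phi> [b]) @ nodes t (\<phi> w)"
    by (simp add: image_Cons[OF b] nodes_append)
  show ?case
  proof (cases "i < length (\<phi> [b])")
    case True
    then have "nodes t (b # w) ! i = (b, i)"
      by (simp add: nodes_Cons b nth_append)
    then show ?thesis
      using child_eq_nth[OF b(1) True \<open>d < k\<close>] by (simp add: eq nth_append)
  next
    case False
    define i' where "i' = i - length (\<phi> [b])"
    then have i: "i = length (\<phi> [b]) + i'" using False by simp
    have "k * i + d = length (nodes t (\<phi> [b])) + (k * i' + d)"
      by (simp add: i len distrib_left)
    then have "nodes t (\<phi> (b # w)) ! (k * i + d) = nodes t (\<phi> w) ! (k * i' + d)"
      by (simp only: eq nth_append_length_plus)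
    also have "\<dots> = child t (nodes t w ! i') d"
      using Cons.prems b by (intro Cons.IH) (simp_all add: i image_Cons[of b w])
    also have "nodes t w ! i' = nodes t (b # w) ! i"
      by (simp add: nodes_Cons b i nth_append)
    finally show ?thesis .
  qed
qed (simp add: image_Nil)

text \<open>
  The excess of the letter sum over its mean value depends only on the node: every complete block
  \<open>\<phi>(b)\<close> has the same mean letter as \<open>\<phi>(a)\<close>.
\<close>

lemma sum_list_take_image:
  "set w \<subseteq> \<Sigma> \<Longrightarrow> i < length (\<phi> w) \<Longrightarrow> nodes t w ! i = (b, p) \<Longrightarrow>
     length (\<phi> [a]) * sum_list (take i (\<phi> w)) + sum_list (\<phi> [a]) * p =
     length (\<phi> [a]) * sum_list (take p (\<phi> [b])) + sum_list (\<phi> [a]) * i"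
proof (induction w arbitrary: i)
  case (Cons c w)
  then have c: "c \<in> \<Sigma>" "set w \<subseteq> \<Sigma>" by auto
  show ?case
  proof (cases "i < length (\<phi> [c])")
    case True
    then have "c = b" "i = p"
      using Cons.prems by (simp_all add: nth_append nodes_Cons c)
    then show ?thesis
      using True c by (simp add: image_Cons[of b w])
  next
    case False
    define i' where "i' = i - length (\<phi> [c])"
    then have i: "i = length (\<phi> [c]) + i'" using False by simp
    have "length (\<phi> [a]) * sum_list (take i' (\<phi> w)) + sum_list (\<phi> [a]) * p =
        length (\<phi> [a]) * sum_list (take p (\<phi> [b])) + sum_list (\<phi> [a]) * i'"
      using Cons.prems c by (intro Cons.IH) (simp_all add: i image_Cons[of c w] nodes_Cons nth_append)
    \<comment> \<open>By the common mean letter the skipped block contributes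
      \<open>sum_list (\<phi> [a]) * length (\<phi> [c])\<close> to both sides.\<close>
    then show ?thesis
      using sum_list_letter_image[OF c(1)] by (simp add: image_Cons[OF c] i distrib_left)
  qed
qed (simp add: image_Nil)

section \<open>The label sequence of the fixed point\<close>

definition node :: "nat \<Rightarrow> node" where
  "node i = nodes t (map x [0..<LEAST j. i < length (\<phi> (map x [0..<j]))]) ! i"

text \<open>A longer prefix only appends labels, so \<open>LEAST\<close> in \<open>node\<close>
  merely picks one of the prefixes whose image covers \<open>i\<close>.\<close>

lemma node_eq:
  assumes "i < length (\<phi> (map x [0..<j]))"
  shows "node i = nodes t (map x [0..<j]) ! i"
proof -
  define m where "m = (LEAST j. i < length (\<phi> (map x [0..<j])))"
  have m: "m \<le> j" "i < length (\<phi> (map x [0..<m]))"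
    unfolding m_def using assms by (auto intro: Least_le LeastI)
  then have "map x [0..<j] = map x [0..<m] @ map x [m..<j]"
    by (intro map_upt_split)
  then show ?thesis
    unfolding node_def m_def[symmetric]
    using m(2) by (simp add: nodes_append nth_append length_nodes[OF prefix_in])
qed

lemma node_valid: "node i \<in> valid_nodes"
proof -
  obtain j where j: "i < length (\<phi> (map x [0..<j]))"
    using image_prefix_unbounded by blast
  then have "node i \<in> set (nodes t (map x [0..<j]))"
    by (simp add: node_eq length_nodes[OF prefix_in])
  then show ?thesis
    using set_nodes[OF prefix_in] by blast
qed

text \<open>The label sequence is fixed by the \<open>k\<close>-uniform morphism: if
  \<open>v\<close> is a prefix of \<open>x\<close>, so is \<open>\<phi> v\<close>, and the labels
  read off \<open>\<phi> v\<close> are the images of those read off \<open>v\<close>.\<close>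

lemma node_child:
  assumes "d < k"
  shows "node (k * i + d) = child t (node i) d"
proof -
  obtain j where j: "i < length (\<phi> (map x [0..<j]))"
    using image_prefix_unbounded by blast
  let ?m = "length (\<phi> (map x [0..<j]))"
  have "k * i + d < k * Suc i" using assms by simp
  also have "\<dots> \<le> k * ?m" using j by (intro mult_le_mono) auto
  also have "\<dots> = length (\<phi> (\<phi> (map x [0..<j])))"
    by (rule length_image_image[OF prefix_in, symmetric])
  finally have "node (k * i + d) = nodes t (\<phi> (map x [0..<j])) ! (k * i + d)"
    using node_eq[of "k * i + d" ?m] by (simp flip: image_prefix)
  then show ?thesis
    using nodes_image_nth[OF prefix_in j assms] by (simp add: node_eq[OF j])
qed

lemma node_0: "node 0 = (a, 0)"
proof -
  have "x 0 = a"
    using fixed_point_nth[OF morphism a_in prolongable, of 0 0] by simp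
  moreover have "length (\<phi> [a]) > 0"
    using prolongable unfolding prolongable_def by (auto simp: prefix_def)
  ultimately show ?thesis
    using node_eq[of 0 1] nodes_Cons[OF a_in, of "[]"] by (simp add: nth_append)
qed

lemma sum_list_prefix:
  assumes "node i = (b, p)"
  shows "length (\<phi> [a]) * sum_list (map x [0..<i]) + sum_list (\<phi> [a]) * p =
     length (\<phi> [a]) * sum_list (take p (\<phi> [b])) + sum_list (\<phi> [a]) * i"
proof -
  obtain j where j: "i < length (\<phi> (map x [0..<j]))"
    using image_prefix_unbounded by blast
  have "map x [0..<i] = take i (\<phi> (map x [0..<j]))"
    using j by (subst image_prefix) (simp add: take_map)
  then show ?thesis
    using sum_list_take_image[OF prefix_in j] assms by (simp add: node_eq[OF j])
qed

end

section \<open>The window sets and the automaton\<close>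

text \<open>Two maps that identify the same pairs take equally many values; composing with a choice
  of preimages is the bijection. It allows additive classes to be counted by an invariant of another
  type.\<close>

lemma card_image_eq_card_image:
  assumes "\<And>i j. i \<in> A \<Longrightarrow> j \<in> A \<Longrightarrow> f i = f j \<longleftrightarrow> g i = g j"
  shows "card (f ` A) = card (g ` A)"
proof -
  have *: "g (inv_into A f (f i)) = g i" if "i \<in> A" for i
    using assms[of "inv_into A f (f i)" i] that by (simp add: inv_into_into f_inv_into_f)
  then have "g ` A = (\<lambda>y. g (inv_into A f y)) ` f ` A"
    by (force simp: image_image)
  moreover have "inj_on (\<lambda>y. g (inv_into A f y)) (f ` A)"
    using assms * by (auto intro!: inj_onI)
  ultimately show ?thesis by (simp add: card_image)
qed

lemma length_takeWhile_less: "\<exists>x\<in>set xs. \<not> P x \<Longrightarrow> length (takeWhile P xs) < length xs"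
  by (induction xs) auto

lemma set_step: "set (step t d S) = {successor t d e T | T e. T \<in> set S \<and> e < table_trace t}"
  unfolding step_def set_concat set_map image_image set_upt atLeast0LessThan lessThan_def by blast

lemma set_states: "set ` set (states t) = Pow (set (triples t))"
  by (simp add: states_def subseqs_powset)

text \<open>Every set of triples is the set of some subsequence of the list of all triples, so the
  search succeeds.\<close>

lemma state_index:
  assumes "set S \<subseteq> set (triples t)"
  shows "state_index t S < length (states t)"
    and "set (states t ! state_index t S) = set S"
proof -
  let ?P = "\<lambda>S'. \<not> ((\<forall>T\<in>set S. T \<in> set S') \<and> (\<forall>T\<in>set S'. T \<in> set S))"
  have "set S \<in> set ` set (states t)"
    using assms by (simp add: set_states)
  then obtain S' where "S' \<in> set (states t)" "set S' = set S"
    by auto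
  then show less: "state_index t S < length (states t)"
    unfolding state_index_def by (intro length_takeWhile_less) auto
  show "set (states t ! state_index t S) = set S"
    using nth_length_takeWhile[of ?P "states t"] less unfolding state_index_def by blast
qed

context collinear_fixed_point
begin

text \<open>\<open>range (triple n)\<close> is the window set \<open>V\<^sub>n\<close>.\<close>

definition triple :: "nat \<Rightarrow> nat \<Rightarrow> node \<times> node \<times> node" where
  "triple n i = (node i, node (i + n), node (Suc (i + n)))"

lemma set_triples: "set (triples t) = valid_nodes \<times> valid_nodes \<times> valid_nodes"
  by (simp only: triples_def Let_def set_product set_nodes_alphabet)

lemma triple_in: "triple n i \<in> set (triples t)"
  by (simp add: triple_def set_triples node_valid)

lemma child2_node: "e < 2 * k \<Longrightarrow> child2 t (node i) (node (Suc i)) e = node (k * i + e)"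
  using node_child[of "e - k" "Suc i"] by (auto simp: child2_def table_trace node_child)

text \<open>The new end position is \<open>k * (i + n) + (e + d)\<close>. Since
  \<open>Suc (e + d) < 2 * k\<close>, it and the position after it lie in the images of the nodes at
  \<open>i + n\<close> and \<open>Suc (i + n)\<close>.\<close>

lemma successor_triple:
  assumes "d < k" "e < k"
  shows "successor t d e (triple n i) = triple (k * n + d) (k * i + e)"
proof -
  have eq: "k * i + e + (k * n + d) = k * (i + n) + (e + d)"
    by (simp add: distrib_left)
  then show ?thesis
    using assms node_child[OF assms(2), of i] child2_node[of "e + d" "i + n"]
      child2_node[of "Suc (e + d)" "i + n"]
    by (simp add: successor_def triple_def eq)
qed

lemma set_step_range:
  assumes "d < k" "set S = range (triple n)"
  shows "set (step t d S) = range (triple (k * n + d))"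
proof -
  \<comment> \<open>Division with remainder by \<open>k\<close> writes every start position as
    \<open>k * (i div k) + i mod k\<close>, so none is missed.\<close>
  have "triple (k * n + d) i = successor t d (i mod k) (triple n (i div k))" for i
    using trace_ge_2 assms(1) by (subst successor_triple) simp_all
  moreover have "i mod k < k" for i
    using trace_ge_2 by simp
  ultimately have "range (triple (k * n + d)) \<subseteq> set (step t d S)"
    unfolding set_step assms(2) table_trace by blast
  moreover have "set (step t d S) \<subseteq> range (triple (k * n + d))"
    unfolding set_step assms(2) table_trace using successor_triple[OF assms(1)] by blast
  ultimately show ?thesis by (rule equalityI[rotated])
qed

text \<open>Well-formedness concerns all states, including sets of triples that are no window set,
  so closure is shown for arbitrary \<open>S\<close>.\<close>

lemma set_step_triples:
  assumes "d < k" "set S \<subseteq> set (triples t)"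
  shows "set (step t d S) \<subseteq> set (triples t)"
proof -
  have "child2 t u v e \<in> valid_nodes" if "u \<in> valid_nodes" "v \<in> valid_nodes" "e < 2 * k" for u v e
    using that child_valid[of v "e - k"] by (auto simp: child2_def table_trace child_valid)
  then have "successor t d e T \<in> set (triples t)" if "T \<in> set (triples t)" "e < k" for T e
    using that assms(1) by (auto simp: set_triples successor_def child_valid)
  then show ?thesis
    using assms(2) unfolding set_step table_trace by blast
qed

text \<open>The digit 1 exists because \<open>k\<close> is at least 2, so \<open>node 1\<close> is a
  child of \<open>node 0\<close>.\<close>

lemma root_eq: "root t a = triple 0 0"
  using node_child[of 1 0] trace_ge_2 by (simp add: root_def triple_def node_0)

lemma set_initial: "set (initial t a) = range (triple 0)"
proof (intro equalityI subsetI)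
  fix T
  assume T: "T \<in> set (initial t a)"
  \<comment> \<open>The window set for length 0 is itself one of the sets intersected: it contains
    the root, and it is closed because \<open>k * 0 + 0 = 0\<close>.\<close>
  have "range (triple 0) \<in> set ` set (states t)"
    using triple_in by (auto simp: set_states)
  then obtain S where S: "S \<in> set (states t)" "set S = range (triple 0)"
    by (metis imageE)
  moreover have "set (step t 0 S) = set S"
    using set_step_range[OF _ S(2), of 0] trace_ge_2 S(2) by simp
  ultimately show "T \<in> range (triple 0)"
    using T root_eq unfolding initial_def by auto
next
  fix T
  assume "T \<in> range (triple 0)"
  \<comment> \<open>Conversely, every closed set containing the root contains all window triples:
    the one at \<open>i > 0\<close> is a successor of the one at the smaller position
    \<open>i div k\<close>.\<close>
  moreover have "triple 0 i \<in> set S"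
    if S: "root t a \<in> set S" "\<forall>T\<in>set (step t 0 S). T \<in> set S" for S i
  proof (induction i rule: less_induct)
    case (less i)
    show ?case
    proof (cases "i = 0")
      case False
      have "triple 0 (i div k) \<in> set S"
        using less False trace_ge_2 by simp
      moreover have "successor t 0 (i mod k) (triple 0 (i div k)) = triple 0 i"
        using trace_ge_2 by (subst successor_triple) simp_all
      moreover have "i mod k < k"
        using trace_ge_2 by simp
      ultimately have "triple 0 i \<in> set (step t 0 S)"
        unfolding set_step table_trace by (metis (mono_tags, lifting) mem_Collect_eq)
      then show ?thesis using S(2) by blast
    qed (use S(1) root_eq in simp)
  qed
  ultimately show "T \<in> set (initial t a)"
    unfolding initial_def using triple_in by auto
qed

section \<open>From windows to additive classes\<close>

lemma node_diff_node:
  "node_diff t a (node i) (node (i + n)) =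
    (length (\<phi> [a]) * sum_list (map x [i..<i + n]) - sum_list (\<phi> [a]) * n,
     sum_list (\<phi> [a]) * n - length (\<phi> [a]) * sum_list (map x [i..<i + n]))"
proof -
  obtain b p b' p' where node: "node i = (b, p)" "node (i + n) = (b', p')"
    by (meson surj_pair)
  then have in_alphabet: "b \<in> \<Sigma>" "b' \<in> \<Sigma>"
    using node_valid[of i] node_valid[of "i + n"] by (auto simp: valid_nodes_def)
  let ?A = "length (\<phi> [a])" and ?B = "sum_list (\<phi> [a])" and ?s = "sum_list (map x [i..<i + n])"
  let ?P = "?A * sum_list (take p' (\<phi> [b'])) + ?B * p"
    and ?Q = "?A * sum_list (take p (\<phi> [b])) + ?B * p'"
  have "sum_list (map x [0..<i + n]) = sum_list (map x [0..<i]) + ?s"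
    by (subst map_upt_split[of i]) simp_all
  \<comment> \<open>The prefix identities at \<open>i\<close> and \<open>i + n\<close> are
    subtracted with negative terms moved across; the sum of the first \<open>i\<close> letters
    cancels. Hence both truncated differences agree with those of the window.\<close>
  then have "?P + ?B * n = ?Q + ?A * ?s"
    using sum_list_prefix[OF node(1)] sum_list_prefix[OF node(2)] by (simp add: distrib_left)
  then have "?P - ?Q = ?A * ?s - ?B * n" "?Q - ?P = ?B * n - ?A * ?s"
    by linarith+
  then show ?thesis
    by (simp add: node_diff_def Let_def node letter_image a_in in_alphabet)
qed

lemma additive_equiv_image_eq_iff:
  assumes "set u \<subseteq> \<Sigma>" "set v \<subseteq> \<Sigma>" "length u = length v"
  shows "additive_equiv \<Sigma> `` {u} = additive_equiv \<Sigma> `` {v} \<longleftrightarrow> sum_list u = sum_list v"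
proof -
  have sum: "(\<Sum>c\<in>\<Sigma>. c * count_list w c) = sum_list w" if "set w \<subseteq> \<Sigma>" for w
    using sum_list_eq_sum_count[OF finite_alphabet that, of "\<lambda>c. c"] by (simp add: mult.commute)
  have class_eq: "additive_equiv \<Sigma> `` {w} =
      {w'. set w' \<subseteq> \<Sigma> \<and> length w = length w' \<and> sum_list w = sum_list w'}" if "set w \<subseteq> \<Sigma>" for w
    using that sum by (auto simp: additive_equiv_def lists_eq_set simp del: in_lists_conv_set)
  have "v \<in> additive_equiv \<Sigma> `` {v}"
    using assms(2) by (simp add: class_eq)
  then show ?thesis
    using assms by (auto simp: class_eq)
qed

text \<open>Among windows of length \<open>n\<close> the class is determined by the letter sum. As
  \<open>|\<phi>(a)| > 0\<close>, the scaled and shifted sum in \<open>node_diff\<close> is an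
  equally fine invariant.\<close>

lemma additive_complexity_eq:
  "additive_complexity \<Sigma> x n = card (range (\<lambda>i. node_diff t a (node i) (node (i + n))))"
proof -
  have "factors x n // additive_equiv \<Sigma> = range (\<lambda>i. additive_equiv \<Sigma> `` {map x [i..<i + n]})"
    by (auto simp: factors_def quotient_def)
  moreover have "length (\<phi> [a]) > 0"
    using prolongable unfolding prolongable_def by (auto simp: prefix_def)
  then have "node_diff t a (node i) (node (i + n)) = node_diff t a (node j) (node (j + n)) \<longleftrightarrow>
      sum_list (map x [i..<i + n]) = sum_list (map x [j..<j + n])" for i j
  proof -
    \<comment> \<open>The two truncated differences together determine the integer difference, hence
      \<open>p\<close>.\<close>
    have "(p - c, c - p) = (q - c, c - q) \<longleftrightarrow> p = q" for p q c :: nat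
      by auto
    with \<open>length (\<phi> [a]) > 0\<close> show ?thesis
      unfolding node_diff_node by simp
  qed
  ultimately show ?thesis
    unfolding additive_complexity_def
    by (simp only:) (intro card_image_eq_card_image,
        simp add: additive_equiv_image_eq_iff[OF prefix_in prefix_in])
qed

lemma diff_count_eq:
  assumes "set S = range (triple n)"
  shows "diff_count t a S = additive_complexity \<Sigma> x n"
  using assms
  by (simp add: diff_count_def length_remdups_card_conv additive_complexity_eq image_image triple_def)

text \<open>The digits of \<open>n\<close> are those of \<open>n div k\<close> followed by
  \<open>n mod k\<close>, so one step leads from the window set of the quotient to that of
  \<open>n\<close>. Zero has the empty representation, which makes \<open>V\<^sub>0\<close> the
  initial state.\<close>

lemma run_automaton:
  fixes n
  defines "q \<equiv> foldl (\<lambda>q d. trans (automaton t a) ! q ! d) (init (automaton t a)) (base_rep k n)"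
  shows "q < length (states t) \<and> set (states t ! q) = range (triple n)"
  unfolding q_def
proof (induction n rule: less_induct)
  case (less n)
  show ?case
  proof (cases "n = 0")
    case True
    have "set (initial t a) \<subseteq> set (triples t)"
      using triple_in by (auto simp: set_initial)
    with state_index[of "initial t a" t] True show ?thesis
      by (simp add: base_rep.simps[of k 0] automaton_def set_initial)
  next
    case False
    define p where "p =
      foldl (\<lambda>q d. trans (automaton t a) ! q ! d) (init (automaton t a)) (base_rep k (n div k))"
    define S where "S = step t (n mod k) (states t ! p)"
    have p: "p < length (states t)" "set (states t ! p) = range (triple (n div k))"
      unfolding p_def using less[of "n div k"] False trace_ge_2 by simp_all
    have S: "set S = range (triple n)"
      unfolding S_def using set_step_range[OF _ p(2), of "n mod k"] trace_ge_2 by simp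
    have "foldl (\<lambda>q d. trans (automaton t a) ! q ! d) (init (automaton t a)) (base_rep k n) = state_index t S"
      using False trace_ge_2 p(1)
      by (simp add: base_rep.simps[of k n] p_def[symmetric])
        (simp add: automaton_def table_trace S_def)
    moreover have "set S \<subseteq> set (triples t)"
      using S triple_in by auto
    ultimately show ?thesis
      using state_index[of S t] S by simp
  qed
qed

lemma wf_automaton: "wf_dfao k (automaton t a)"
proof -
  have "set (initial t a) \<subseteq> set (triples t)"
    using triple_in by (auto simp: set_initial)
  moreover have "set S \<subseteq> set (triples t)" if "S \<in> set (states t)" for S
    using that set_states[of t] by blast
  ultimately show ?thesis
    using state_index(1)[OF set_step_triples] state_index(1)[of "initial t a" t]
    by (auto simp: wf_dfao_def automaton_def table_trace)
qed

theorem generates_automaton: "generates k (automaton t a) (additive_complexity \<Sigma> x)"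
  unfolding generates_def dfao_output_def
  using trace_ge_2 wf_automaton run_automaton diff_count_eq by (auto simp: automaton_def)

end

theorem theorem3p10:
  "(\<forall>\<Sigma> \<phi> a. admissible \<Sigma> \<phi> a \<longrightarrow>
      automatic (trace_morphism \<Sigma> \<phi>) (additive_complexity \<Sigma> (fixed_point \<phi> a))) \<and>
   (\<exists>F. computable F \<and>
      (\<forall>\<Sigma> \<phi> a. admissible \<Sigma> \<phi> a \<longrightarrow>
         (\<exists>M. F (encode_morphism \<Sigma> \<phi> a) = Some (encode_dfao M) \<and>
              generates (trace_morphism \<Sigma> \<phi>) M
                (additive_complexity \<Sigma> (fixed_point \<phi> a)))))"
proof -
  have generates: "generates (trace_morphism \<Sigma> \<phi>) (automaton (morphism_table \<Sigma> \<phi>) a)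
      (additive_complexity \<Sigma> (fixed_point \<phi> a))" if "admissible \<Sigma> \<phi> a" for \<Sigma> \<phi> a
    using that by (intro collinear_fixed_point.generates_automaton collinear_fixed_point.intro)
  obtain F where F: "computable F"
    "\<And>t a. F (prod_encode (list_encode (map (\<lambda>(b, w). prod_encode (b, list_encode w)) t), a)) =
       Some (encode_dfao (automaton t a))"
    using computable_automaton by blast
  \<comment> \<open>The code of an instance is the code of its table and letter, the inputs of the
    program, so a single \<open>F\<close> serves all instances.\<close>
  have "F (encode_morphism \<Sigma> \<phi> a) = Some (encode_dfao (automaton (morphism_table \<Sigma> \<phi>) a))" for \<Sigma> \<phi> a
    using F(2)[of "morphism_table \<Sigma> \<phi>" a]
    by (simp add: encode_morphism_def morphism_table_def comp_def)
  with F(1) generates show ?thesis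
    unfolding automatic_def by blast
qed

end
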